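(* Suppose there exist a point $\bar x\in\mathbb{R}^n$ and $\epsilon>0$ such that $\langle a_j,\bar x\rangle-b_j\le-\epsilon$ for all $j=1,\ldots,m$. Let $\delta^0>0$ be a given accuracy level and let $$\Gamma=\max\left\{L\left(\frac{1}{m\beta}-\frac{\sqrt{\delta}}{4\alpha_{\min}}\right)^{-1},\ 4mL\alpha_{\max}\left(\frac{1}{\sqrt{\delta}}+\frac{\beta m}{\alpha_{\min}}\right)\right\},$$ with $L=L(c,\epsilon)$ the subgradient bound defined in the context. (a) Let $f$ be strongly convex with a parameter $\mu_f>0$ and have Lipschitz continuous gradients with a constant $L_f>0$. Let $x^*$ be the solution of the original problem $\min_{x\in X}f(x)$. Assume that $\gamma>0$ and $\delta$ satisfy $$0<\delta<\min\left\{\epsilon,\frac{16\alpha_{\min}^2}{\beta^2m^2}\right\},\qquad \Gamma\le\gamma\le\frac{2\mu_f\alpha_{\min}\delta^0}{\delta},$$ where $L=L(c,\epsilon)$ with $c>2\mu_f\alpha_{\min}\delta^0$, and that the step size is $\alpha=\frac{1}{2\left(\mu_fm+L_f+\frac{\gamma\alpha_{\max}}{2\delta}\right)}$. Then the iterates $x^t$ of the SAGA-based method described in the context satisfy $$\mathbb{E}\left[\|x^t-\Pi_X[x^t]\|^2\right]\le O(q_\gamma^t),\qquad \mathbb{E}\left[\|x^t-x^*\|^2\right]\le O(q_\gamma^t)+2\delta^0,$$ $$q_\gamma=1-\frac{\mu_f}{2\left(\mu_fm+L_f+\frac{\gamma\alpha_{\max}}{2\delta}\right)}.$$ (b) Let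 $f$ be convex, have bounded level sets and have Lipschitz continuous gradients with a constant $L_f>0$. Let $f^*=\min_{z\in X}f(z)$. Assume that $\gamma>0$ and $\delta$ satisfy $$0<\delta<\min\left\{\epsilon,\frac{16\alpha_{\min}^2}{\beta^2m^2}\right\},\qquad \Gamma\le\gamma\le\frac{4\alpha_{\min}\delta^0}{\delta},$$ where $L=L(c,\epsilon)$ with $c>4\alpha_{\min}\delta^0$, and that the step size is $\alpha=\frac{1}{3\left(L_f+\frac{\gamma\alpha_{\max}}{2\delta}\right)}$. Then, for the averages $\bar x^t=\frac1t\sum_{k=1}^tx^k$ of the iterates $x^k$ generated by the SAGA-based method described in the context, $$\mathbb{E}[f(\bar x^t)]-f^*\le O\left(\frac{4m}{t}\right)+2\delta^0\qquad\text{for all }t,$$ and for any $\tilde\epsilon>0$ there exists $T>0$ such that for all $t>T$, $$-\gamma\tilde\epsilon\le\mathbb{E}[f(\bar x^t)]-f^*.$$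
   Context: Original problem: minimize a convex function $f:\mathbb{R}^n\to\mathbb{R}$ subject to $\langle a_i,x\rangle-b_i\le0$, $i=1,\ldots,m$ ($m\ge2$), where $a_i\in\mathbb{R}^n$ are nonzero and $b_i\in\mathbb{R}$. The problem is feasible. Put $X_i=\{x\in\mathbb{R}^n\mid\langle a_i,x\rangle-b_i\le0\}$ and $X=\cap_{i=1}^mX_i$. Norms are Euclidean, $\Pi_Y[x]$ is the Euclidean projection onto a closed convex set $Y$, and $\mathrm{dist}(x,Y)=\|x-\Pi_Y[x]\|$. For nonzero $a\in\mathbb{R}^n$, $b\in\mathbb{R}$ and $\delta>0$: $h_\delta(x;a,b)=\frac{\langle a,x\rangle-b}{\|a\|}$ if $\langle a,x\rangle-b>\delta$; $h_\delta(x;a,b)=\frac{(\langle a,x\rangle-b+\delta)^2}{4\delta\|a\|}$ if $-\delta\le\langle a,x\rangle-b\le\delta$; $h_\delta(x;a,b)=0$ if $\langle a,x\rangle-b<-\delta$. This function is differentiable in $x$. Penalized objective: $F_{\gamma\delta}(x)=f(x)+\frac{\gamma}{m}\sum_{i=1}^mh_\delta(x;a_i,b_i)=\frac1m\sum_{i=1}^mg_i(x)$ with $g_i(x)=f(x)+\gamma h_\delta(x;a_i,b_i)$. $X^*_{\gamma\delta}$ is the set of minimizers of $F_{\gamma\delta}$ over $\mathbb{R}^n$. SAGA-based method (step size $\alpha>0$): start with $x^0\in\mathbb{R}^n$ and $\phi_i^0=x^0$ for $i=1,\ldots,m$. At each iteration $t=0,1,\ldots$: pick an index $j\in\{1,\ldots,m\}$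 uniformly at random (independently of the past); set $\phi_j^{t+1}=x^t$ and $\phi_i^{t+1}=\phi_i^t$ for $i\ne j$; set $$x^{t+1}=x^t-\alpha\left[\nabla g_j(\phi_j^{t+1})-\nabla g_j(\phi_j^t)+\frac1m\sum_{i=1}^m\nabla g_i(\phi_i^t)\right].$$ $\mathbb{E}$ is the expectation over the random indices. In the $O(\cdot)$ bounds the implied constants do not depend on $t$. $\alpha_{\min}=\min_j\|a_j\|$, $\alpha_{\max}=\max_j\|a_j\|$. Hoffman's constant: $\beta=\beta(a_1,\ldots,a_m)>0$ is a constant depending only on $a_1,\ldots,a_m$ (not on the right-hand sides) such that, for every choice of right-hand sides $b'_1,\ldots,b'_m\in\mathbb{R}$ for which $Y=\cap_iY_i\ne\emptyset$ with $Y_i=\{x\mid\langle a_i,x\rangle\le b'_i\}$, one has $\beta\sum_{i=1}^m\mathrm{dist}(x,Y_i)\ge\mathrm{dist}(x,Y)$ for all $x\in\mathbb{R}^n$ (in particular for $X_i$ and $X$). Subgradient bound: $R(c,\epsilon)>0$ is a radius such that, for all $\gamma>0$ and $0<\delta\le\epsilon$ with $\gamma\delta\le c$ and every $x\in X^*_{\gamma\delta}$, the ball $\{z\mid\|z\|\le R(c,\epsilon)\}$ contains $\Pi_X[x]$ and every feasible point $x_{in}\in X$ satisfying $\|x-x_{in}\|\le\|x-\Pi_X[x]\|+\frac{\beta m\delta}{\alpha_{\min}}$ (such a radius exists when $f$ has bounded level sets, in particular when $f$ is strongly convex). Then $L(c,\epsilon)=\max\{\|s\|\mid s\in\partial f(x),\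 \|x\|\le R(c,\epsilon)\}$, where $\partial f(x)$ is the subdifferential. *)

theory Defs
  imports "HOL-Probability.Probability"
begin

definition halfspaces_inter :: "nat \<Rightarrow> (nat \<Rightarrow> 'a::euclidean_space) \<Rightarrow> (nat \<Rightarrow> real) \<Rightarrow> 'a set" where
  "halfspaces_inter m a b = (\<Inter>i\<in>{1..m}. {x. a i \<bullet> x - b i \<le> 0})"

definition proj_dist :: "'a::euclidean_space \<Rightarrow> 'a set \<Rightarrow> real" where
  "proj_dist x Y = norm (x - closest_point Y x)"

definition norm_min :: "nat \<Rightarrow> (nat \<Rightarrow> 'a::euclidean_space) \<Rightarrow> real" where
  "norm_min m a = Min ((\<lambda>j. norm (a j)) ` {1..m})"

definition norm_max :: "nat \<Rightarrow> (nat \<Rightarrow> 'a::euclidean_space) \<Rightarrow> real" where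
  "norm_max m a = Max ((\<lambda>j. norm (a j)) ` {1..m})"

definition is_hoffman_constant :: "nat \<Rightarrow> (nat \<Rightarrow> 'a::euclidean_space) \<Rightarrow> real \<Rightarrow> bool" where
  "is_hoffman_constant m a \<beta> \<longleftrightarrow> \<beta> > 0 \<and>
     (\<forall>b'. halfspaces_inter m a b' \<noteq> {} \<longrightarrow>
       (\<forall>x. \<beta> * (\<Sum>i=1..m. proj_dist x {z. a i \<bullet> z \<le> b' i})
              \<ge> proj_dist x (halfspaces_inter m a b')))"

definition huber_penalty :: "real \<Rightarrow> 'a::euclidean_space \<Rightarrow> real \<Rightarrow> 'a \<Rightarrow> real" where
  "huber_penalty \<delta> a b x =
     (if a \<bullet> x - b > \<delta> then (a \<bullet> x - b) / norm a
      else if - \<delta> \<le> a \<bullet> x - b then (a \<bullet> x - b + \<delta>)\<^sup>2 / (4 * \<delta> * norm a)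
      else 0)"

definition penalized_component ::
  "('a::euclidean_space \<Rightarrow> real) \<Rightarrow> (nat \<Rightarrow> 'a) \<Rightarrow> (nat \<Rightarrow> real) \<Rightarrow> real \<Rightarrow> real \<Rightarrow> nat \<Rightarrow> 'a \<Rightarrow> real" where
  "penalized_component f a b \<gamma> \<delta> i x = f x + \<gamma> * huber_penalty \<delta> (a i) (b i) x"

definition penalized_objective ::
  "('a::euclidean_space \<Rightarrow> real) \<Rightarrow> nat \<Rightarrow> (nat \<Rightarrow> 'a) \<Rightarrow> (nat \<Rightarrow> real) \<Rightarrow> real \<Rightarrow> real \<Rightarrow> 'a \<Rightarrow> real" where
  "penalized_objective f m a b \<gamma> \<delta> x =
     f x + \<gamma> / real m * (\<Sum>i=1..m. huber_penalty \<delta> (a i) (b i) x)"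

definition penalized_minimizers ::
  "('a::euclidean_space \<Rightarrow> real) \<Rightarrow> nat \<Rightarrow> (nat \<Rightarrow> 'a) \<Rightarrow> (nat \<Rightarrow> real) \<Rightarrow> real \<Rightarrow> real \<Rightarrow> 'a set" where
  "penalized_minimizers f m a b \<gamma> \<delta> =
     {x. is_arg_min (penalized_objective f m a b \<gamma> \<delta>) (\<lambda>_. True) x}"

definition subdiff :: "('a::euclidean_space \<Rightarrow> real) \<Rightarrow> 'a \<Rightarrow> 'a set" where
  "subdiff f x = {s. \<forall>y. f y \<ge> f x + s \<bullet> (y - x)}"

definition is_subgradient_radius ::
  "('a::euclidean_space \<Rightarrow> real) \<Rightarrow> nat \<Rightarrow> (nat \<Rightarrow> 'a) \<Rightarrow> (nat \<Rightarrow> real) \<Rightarrow> real \<Rightarrow> real \<Rightarrow> real \<Rightarrow> real \<Rightarrow> bool" where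
  "is_subgradient_radius f m a b \<beta> c \<epsilon> R \<longleftrightarrow> R > 0 \<and>
     (\<forall>\<gamma> \<delta>. \<gamma> > 0 \<and> 0 < \<delta> \<and> \<delta> \<le> \<epsilon> \<and> \<gamma> * \<delta> \<le> c \<longrightarrow>
       (\<forall>x \<in> penalized_minimizers f m a b \<gamma> \<delta>.
          closest_point (halfspaces_inter m a b) x \<in> cball 0 R \<and>
          (\<forall>x\<^sub>i\<^sub>n \<in> halfspaces_inter m a b.
             norm (x - x\<^sub>i\<^sub>n) \<le> norm (x - closest_point (halfspaces_inter m a b) x)
                               + \<beta> * real m * \<delta> / norm_min m a
             \<longrightarrow> x\<^sub>i\<^sub>n \<in> cball 0 R)))"

(* For a finite convex function on a Euclidean space this maximum is attained. *)
definition subgradient_bound :: "('a::euclidean_space \<Rightarrow> real) \<Rightarrow> real \<Rightarrow> real" where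
  "subgradient_bound f R =
     (GREATEST l. l \<in> {norm s | s x. s \<in> subdiff f x \<and> norm x \<le> R})"

definition penalty_threshold :: "nat \<Rightarrow> (nat \<Rightarrow> 'a::euclidean_space) \<Rightarrow> real \<Rightarrow> real \<Rightarrow> real \<Rightarrow> real" where
  "penalty_threshold m a \<beta> L \<delta> =
     max (L * inverse (1 / (real m * \<beta>) - sqrt \<delta> / (4 * norm_min m a)))
         (4 * real m * L * norm_max m a * (1 / sqrt \<delta> + \<beta> * real m / norm_min m a))"

definition strongly_convex :: "real \<Rightarrow> ('a::euclidean_space \<Rightarrow> real) \<Rightarrow> bool" where
  "strongly_convex \<mu> f \<longleftrightarrow>
     (\<forall>x y. \<forall>u\<in>{0..1}. f (u *\<^sub>R x + (1 - u) *\<^sub>R y)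
        \<le> u * f x + (1 - u) * f y - \<mu> / 2 * u * (1 - u) * (norm (x - y))\<^sup>2)"

definition bounded_level_sets :: "('a::euclidean_space \<Rightarrow> real) \<Rightarrow> bool" where
  "bounded_level_sets f \<longleftrightarrow> (\<forall>r. bounded {x. f x \<le> r})"

definition gradient :: "('a::euclidean_space \<Rightarrow> real) \<Rightarrow> 'a \<Rightarrow> 'a" where
  "gradient f x = (THE D. GDERIV f x :> D)"

definition has_lipschitz_gradient :: "real \<Rightarrow> ('a::euclidean_space \<Rightarrow> real) \<Rightarrow> bool" where
  "has_lipschitz_gradient K f \<longleftrightarrow>
     (\<forall>x. f differentiable (at x)) \<and> K-lipschitz_on UNIV (gradient f)"

(* The state is the pair of the iterate x^t and the table i \<mapsto> \<phi>_i^t;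
   g i are the component functions and js is the realized index sequence. *)
primrec saga_state ::
  "(nat \<Rightarrow> 'a::euclidean_space \<Rightarrow> real) \<Rightarrow> nat \<Rightarrow> real \<Rightarrow> 'a \<Rightarrow> (nat \<Rightarrow> nat) \<Rightarrow> nat \<Rightarrow> 'a \<times> (nat \<Rightarrow> 'a)" where
  "saga_state g m \<alpha> x0 js 0 = (x0, \<lambda>i. x0)"
| "saga_state g m \<alpha> x0 js (Suc t) =
     (let (x, \<phi>) = saga_state g m \<alpha> x0 js t; j = js t; \<phi>' = \<phi>(j := x)
      in (x - \<alpha> *\<^sub>R (gradient (g j) (\<phi>' j) - gradient (g j) (\<phi> j)
                   + (1 / real m) *\<^sub>R (\<Sum>i=1..m. gradient (g i) (\<phi> i))), \<phi>'))"

definition saga_iterate ::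
  "(nat \<Rightarrow> 'a::euclidean_space \<Rightarrow> real) \<Rightarrow> nat \<Rightarrow> real \<Rightarrow> 'a \<Rightarrow> (nat \<Rightarrow> nat) \<Rightarrow> nat \<Rightarrow> 'a" where
  "saga_iterate g m \<alpha> x0 js t = fst (saga_state g m \<alpha> x0 js t)"

definition saga_average ::
  "(nat \<Rightarrow> 'a::euclidean_space \<Rightarrow> real) \<Rightarrow> nat \<Rightarrow> real \<Rightarrow> 'a \<Rightarrow> (nat \<Rightarrow> nat) \<Rightarrow> nat \<Rightarrow> 'a" where
  "saga_average g m \<alpha> x0 js t = (1 / real t) *\<^sub>R (\<Sum>k=1..t. saga_iterate g m \<alpha> x0 js k)"

definition iid_uniform_indices :: "'w measure \<Rightarrow> nat \<Rightarrow> (nat \<Rightarrow> 'w \<Rightarrow> nat) \<Rightarrow> bool" where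
  "iid_uniform_indices M m J \<longleftrightarrow> prob_space M \<and>
     prob_space.indep_vars M (\<lambda>_. count_space {1..m}) J UNIV \<and>
     (\<forall>t. distr M (count_space {1..m}) (J t) = uniform_count_measure {1..m})"

end

theory Submission
  imports Defs
begin

text \<open>
  Three facts carry the result.

  \<^item> The penalty is exact: every minimizer \<open>z\<close> of the penalized objective \<open>F\<close> is feasible
  (\<open>penalized_minimizer_feasible\<close>). The Huber penalty dominates the distance to a half-space and
  exceeds it by at most \<open>\<delta> / (4 * norm (a i))\<close>, so Hoffman's inequality makes the penalty of a point at
  distance \<open>d\<close> from the feasible set at least of order \<open>\<gamma> * d\<close>, whereas \<open>f\<close> can gain at most
  \<open>L * d\<close> by leaving it. This settles \<open>d > sqrt \<delta>\<close>. Closer to the boundary the smoothing error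
  spoils the comparison, but there the comparison point can be chosen in the half-spaces tightened
  by \<open>\<delta>\<close>, where the penalty vanishes, while each violated constraint already costs more than the
  boundary value \<open>\<delta> / (4 * norm (a i))\<close>. The two entries of the threshold for \<open>\<gamma>\<close> are what these
  two cases require.

  \<^item> The penalty is accurate: on the feasible set \<open>F\<close> exceeds \<open>f\<close> by at most
  \<open>\<gamma> * \<delta> / (4 * norm_min m a)\<close>, so \<open>f z\<close> is that close to the constrained minimum, and the upper bound
  on \<open>\<gamma>\<close> turns this into a multiple of \<open>\<delta>0\<close>. Under strong convexity it also bounds the
  distance from \<open>z\<close> to the constrained minimizer.

  \<^item> SAGA minimizes \<open>F\<close>, which is an average of \<open>m\<close> convex functions with Lipschitz gradients. Its
  rates come from the potential of Defazio, Bach and Lacoste-Julien: the mean Bregman divergence of the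
  table entries plus a multiple of the squared distance of the iterate to \<open>z\<close>. One step multiplies
  its mean by \<open>1 - \<alpha> * \<mu>\<close> in the strongly convex case (\<open>potential_contraction\<close>), and
  lowers it by \<open>1 / m\<close> times the optimality gap in the convex case (\<open>potential_decrease\<close>).

  Since \<open>z\<close> is feasible, the distance of an iterate to the feasible set is at most its distance to \<open>z\<close>,
  and the remaining upper bounds follow by adding the penalty error. The lower bound on the averages in
  the convex case needs a further argument, because \<open>f\<close> may drop below the constrained minimum at
  infeasible points: by compactness, a drop by a fixed amount forces a gap in \<open>F\<close> that is bounded
  away from zero (\<open>infeasibility_controlled_by_gap\<close>), and the expected gap tends to zero.
\<close>

section \<open>Convex functions with Lipschitz gradients\<close>

lemma gradient_eqI:
  fixes f :: "'a::euclidean_space \<Rightarrow> real"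
  assumes "GDERIV f x :> D"
  shows "gradient f x = D"
  unfolding gradient_def
proof (rule the_equality)
  show "GDERIV f x :> D" by (rule assms)
  fix E assume "GDERIV f x :> E"
  with assms have "(\<lambda>h. h \<bullet> D) = (\<lambda>h. h \<bullet> E)"
    unfolding gderiv_def by (rule has_derivative_unique)
  then have "\<And>h. h \<bullet> D = h \<bullet> E" by meson
  then show "E = D" using vector_eq_ldot[of E D] by auto
qed

lemma differentiable_imp_GDERIV:
  fixes f :: "'a::euclidean_space \<Rightarrow> real"
  assumes "f differentiable (at x)"
  shows "GDERIV f x :> gradient f x"
proof -
  obtain f' where f': "(f has_derivative f') (at x)"
    using assms unfolding differentiable_def by auto
  then have lin: "linear f'" by (rule has_derivative_linear)
  have "f' h = h \<bullet> adjoint f' 1" for h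
    using adjoint_works[OF lin, of h 1] by simp
  then have "f' = (\<lambda>h. h \<bullet> adjoint f' 1)" by (rule ext)
  then have "GDERIV f x :> adjoint f' 1"
    using f' unfolding gderiv_def by metis
  with gradient_eqI show ?thesis by metis
qed

lemma GDERIV_along_line:
  fixes f :: "'a::euclidean_space \<Rightarrow> real"
  assumes "GDERIV f (x + t *\<^sub>R d) :> D"
  shows "((\<lambda>s. f (x + s *\<^sub>R d)) has_real_derivative d \<bullet> D) (at t)"
proof -
  have f: "(f has_derivative (\<lambda>h. h \<bullet> D)) (at (x + t *\<^sub>R d))"
    using assms by (simp add: gderiv_def)
  have "((\<lambda>s. x + s *\<^sub>R d) has_derivative (\<lambda>h. h *\<^sub>R d)) (at t)"
    by (auto intro!: derivative_eq_intros)
  from has_derivative_compose[OF this f]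
  have "((\<lambda>s. f (x + s *\<^sub>R d)) has_derivative (\<lambda>h. h *\<^sub>R d \<bullet> D)) (at t)" .
  then show ?thesis
    by (simp add: has_field_derivative_def mult_commute_abs)
qed

lemma convex_on_UNIV_imp_above_tangent:
  fixes f :: "'a::euclidean_space \<Rightarrow> real"
  assumes f: "convex_on UNIV f" and D: "GDERIV f x :> D"
  shows "f x + D \<bullet> (y - x) \<le> f y"
proof -
  let ?d = "y - x"
  have "convex_on UNIV (\<lambda>s::real. f (x + s *\<^sub>R ?d))"
  proof (rule convex_onI)
    fix t r s :: real assume "0 < t" "t < 1"
    have "x + ((1 - t) *\<^sub>R r + t *\<^sub>R s) *\<^sub>R ?d = (1 - t) *\<^sub>R (x + r *\<^sub>R ?d) + t *\<^sub>R (x + s *\<^sub>R ?d)"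
      by (simp add: algebra_simps)
    with convex_onD[OF f, of t "x + r *\<^sub>R ?d" "x + s *\<^sub>R ?d"] \<open>0 < t\<close> \<open>t < 1\<close>
    show "f (x + ((1 - t) *\<^sub>R r + t *\<^sub>R s) *\<^sub>R ?d)
        \<le> (1 - t) * f (x + r *\<^sub>R ?d) + t * f (x + s *\<^sub>R ?d)"
      by simp
  qed simp
  then have "f (x + 1 *\<^sub>R ?d) - f (x + 0 *\<^sub>R ?d) \<ge> (?d \<bullet> D) * (1 - 0)"
    by (rule convex_on_imp_above_tangent) (use D in \<open>auto intro!: GDERIV_along_line\<close>)
  then show ?thesis by (simp add: inner_commute)
qed

text \<open>Strong convexity is stated between function values. Its consequences at a point come
  from moving a fraction \<open>u\<close> of the way, dividing by \<open>u\<close> and letting it tend to zero.\<close>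

lemma le_if_le_shrinking:
  fixes A B :: real
  assumes "\<And>u. 0 < u \<Longrightarrow> u < 1 \<Longrightarrow> B * (1 - u) \<le> A"
  shows "B \<le> A"
proof (rule tendsto_upperbound)
  show "((\<lambda>u. B * (1 - u)) \<longlongrightarrow> B) (at_right 0)"
    by (auto intro!: tendsto_eq_intros)
  have "\<forall>\<^sub>F u in at_right 0. u \<in> {0<..<1::real}" by (rule eventually_at_right_real) simp
  then show "\<forall>\<^sub>F u in at_right 0. B * (1 - u) \<le> A"
    by eventually_elim (use assms in auto)
qed simp

lemma strongly_convex_imp_convex_on:
  assumes "strongly_convex \<mu> f" "0 \<le> \<mu>"
  shows "convex_on UNIV f"
proof (rule convex_onI)
  fix t x y assume t: "0 < (t::real)" "t < 1"
  have "f (t *\<^sub>R y + (1 - t) *\<^sub>R x) \<le> t * f y + (1 - t) * f x - \<mu> / 2 * t * (1 - t) * (norm (y - x))\<^sup>2"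
    using assms(1) t unfolding strongly_convex_def by auto
  moreover have "0 \<le> \<mu> / 2 * t * (1 - t) * (norm (y - x))\<^sup>2"
    using t assms(2) by simp
  ultimately show "f ((1 - t) *\<^sub>R x + t *\<^sub>R y) \<le> (1 - t) * f x + t * f y"
    by (simp add: add.commute)
qed simp

text \<open>The number \<open>p\<close> is a lower bound for the slope of \<open>f\<close> at \<open>x\<close> towards \<open>y\<close>: it is zero if
  \<open>x\<close> minimizes \<open>f\<close> on the segment, and the directional derivative in general. Strong convexity
  adds its quadratic term to either of them.\<close>

lemma strongly_convex_growth:
  assumes f: "strongly_convex \<mu> f"
    and lb: "\<And>u. 0 < u \<Longrightarrow> u < 1 \<Longrightarrow> f x + u * p \<le> f (u *\<^sub>R y + (1 - u) *\<^sub>R x)"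
  shows "f x + p + \<mu> / 2 * (norm (y - x))\<^sup>2 \<le> f y"
proof -
  have "\<mu> / 2 * (norm (y - x))\<^sup>2 * (1 - u) \<le> f y - f x - p" if u: "0 < u" "u < 1" for u
  proof -
    have "f (u *\<^sub>R y + (1 - u) *\<^sub>R x) \<le> u * f y + (1 - u) * f x - \<mu> / 2 * u * (1 - u) * (norm (y - x))\<^sup>2"
      using f u unfolding strongly_convex_def by auto
    with lb[OF u] have "u * (\<mu> / 2 * (norm (y - x))\<^sup>2 * (1 - u)) \<le> u * (f y - f x - p)"
      by (simp add: algebra_simps)
    with u show ?thesis by simp
  qed
  from le_if_le_shrinking[of "\<mu> / 2 * (norm (y - x))\<^sup>2", OF this] show ?thesis by simp
qed

lemma strongly_convex_min_growth:
  assumes "strongly_convex \<mu> f" "convex S" "x \<in> S" "y \<in> S" "\<And>z. z \<in> S \<Longrightarrow> f x \<le> f z"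
  shows "f x + \<mu> / 2 * (norm (y - x))\<^sup>2 \<le> f y"
proof -
  have "f x + 0 + \<mu> / 2 * (norm (y - x))\<^sup>2 \<le> f y"
  proof (rule strongly_convex_growth[OF assms(1)])
    fix u :: real assume "0 < u" "u < 1"
    then have "u *\<^sub>R y + (1 - u) *\<^sub>R x \<in> S"
      using assms(2-4) by (intro convexD) auto
    then show "f x + u * 0 \<le> f (u *\<^sub>R y + (1 - u) *\<^sub>R x)" using assms(5) by simp
  qed
  then show ?thesis by simp
qed

lemma strongly_convex_above_tangent:
  assumes f: "strongly_convex \<mu> f" "0 \<le> \<mu>" and D: "GDERIV f x :> D"
  shows "f x + D \<bullet> (y - x) + \<mu> / 2 * (norm (y - x))\<^sup>2 \<le> f y"
proof (rule strongly_convex_growth[OF f(1)])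
  fix u :: real
  have "f x + D \<bullet> (u *\<^sub>R y + (1 - u) *\<^sub>R x - x) \<le> f (u *\<^sub>R y + (1 - u) *\<^sub>R x)"
    by (rule convex_on_UNIV_imp_above_tangent[OF strongly_convex_imp_convex_on[OF f] D])
  moreover have "u *\<^sub>R y + (1 - u) *\<^sub>R x - x = u *\<^sub>R (y - x)" by (simp add: algebra_simps)
  ultimately show "f x + u * (D \<bullet> (y - x)) \<le> f (u *\<^sub>R y + (1 - u) *\<^sub>R x)" by simp
qed

lemma has_lipschitz_gradientD:
  assumes "has_lipschitz_gradient K f"
  shows has_lipschitz_gradient_GDERIV: "GDERIV f x :> gradient f x"
    and has_lipschitz_gradient_norm: "norm (gradient f x - gradient f y) \<le> K * norm (x - y)"
    and has_lipschitz_gradient_nonneg: "0 \<le> K"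
proof -
  show "GDERIV f x :> gradient f x"
    using assms by (intro differentiable_imp_GDERIV) (simp add: has_lipschitz_gradient_def)
  show "norm (gradient f x - gradient f y) \<le> K * norm (x - y)" "0 \<le> K"
    using assms by (auto simp: has_lipschitz_gradient_def lipschitz_on_def dist_norm)
qed

lemma has_lipschitz_gradientI:
  assumes "\<And>x. GDERIV f x :> G x" "\<And>x y. norm (G x - G y) \<le> K * norm (x - y)" "0 \<le> K"
  shows "has_lipschitz_gradient K f"
proof -
  have "gradient f = G" using assms(1) gradient_eqI by blast
  moreover have "f differentiable (at x)" for x
    using assms(1)[of x] unfolding gderiv_def differentiable_def by blast
  ultimately show ?thesis
    using assms(2,3) by (auto simp: has_lipschitz_gradient_def lipschitz_on_def dist_norm)
qed

lemma has_lipschitz_gradient_continuous_on: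
  assumes "has_lipschitz_gradient K f"
  shows "continuous_on S f"
proof -
  have "f differentiable (at x)" for x using assms by (simp add: has_lipschitz_gradient_def)
  then show ?thesis
    by (meson continuous_at_imp_continuous_on differentiable_imp_continuous_within)
qed

text \<open>On the segment from \<open>x\<close> to \<open>y\<close> the difference of the two sides has a derivative of constant
  sign, by the Lipschitz bound and the Cauchy-Schwarz inequality.\<close>

lemma quadratic_upper_bound:
  assumes f: "has_lipschitz_gradient K f"
  shows "f y \<le> f x + gradient f x \<bullet> (y - x) + K / 2 * (norm (y - x))\<^sup>2"
proof -
  define d where "d = y - x"
  let ?G = "gradient f"
  let ?h = "\<lambda>t. f (x + t *\<^sub>R d) - t * (d \<bullet> ?G x) - K / 2 * t\<^sup>2 * (norm d)\<^sup>2"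
  have "?h 1 \<le> ?h 0"
  proof (rule DERIV_nonpos_imp_nonincreasing[where f = ?h])
    fix t :: real assume t: "0 \<le> t" "t \<le> 1"
    have "DERIV (\<lambda>t. f (x + t *\<^sub>R d)) t :> d \<bullet> ?G (x + t *\<^sub>R d)"
      by (rule GDERIV_along_line[OF has_lipschitz_gradient_GDERIV[OF f]])
    then have "DERIV ?h t :> d \<bullet> ?G (x + t *\<^sub>R d) - d \<bullet> ?G x - K * t * (norm d)\<^sup>2"
      by (auto intro!: derivative_eq_intros)
    moreover have "d \<bullet> ?G (x + t *\<^sub>R d) - d \<bullet> ?G x - K * t * (norm d)\<^sup>2 \<le> 0"
    proof -
      have "d \<bullet> (?G (x + t *\<^sub>R d) - ?G x) \<le> norm d * norm (?G (x + t *\<^sub>R d) - ?G x)"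
        by (rule norm_cauchy_schwarz)
      also have "\<dots> \<le> norm d * (K * norm ((x + t *\<^sub>R d) - x))"
        by (intro mult_left_mono has_lipschitz_gradient_norm[OF f]) simp
      also have "\<dots> = K * t * (norm d)\<^sup>2" using t by (simp add: power2_eq_square)
      finally show ?thesis by (simp add: inner_diff_right)
    qed
    ultimately show "\<exists>l. DERIV ?h t :> l \<and> l \<le> 0" by blast
  qed simp
  then show ?thesis by (simp add: d_def inner_commute)
qed

definition bregman :: "('a::euclidean_space \<Rightarrow> real) \<Rightarrow> 'a \<Rightarrow> 'a \<Rightarrow> real" where
  "bregman f z y = f y - f z - gradient f z \<bullet> (y - z)"

lemma bregman_nonneg:
  assumes "strongly_convex \<mu> f" "0 \<le> \<mu>" "has_lipschitz_gradient K f"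
  shows "0 \<le> bregman f z y"
  using convex_on_UNIV_imp_above_tangent[OF strongly_convex_imp_convex_on[OF assms(1,2)]
      has_lipschitz_gradient_GDERIV[OF assms(3)], of z y]
  by (simp add: bregman_def)

text \<open>The tangent of \<open>f\<close> at \<open>z\<close> lies below \<open>f\<close>. Evaluating this at the point reached from \<open>y\<close> by a
  step of length \<open>1 / K\<close> against the gradient difference, where the difference of \<open>f\<close> and the tangent
  has dropped by a known amount, gives the bound.\<close>

lemma bregman_ge_gradient_diff:
  assumes f: "strongly_convex \<mu> f" "0 \<le> \<mu>" "has_lipschitz_gradient K f" and K: "0 < K"
  shows "(norm (gradient f y - gradient f z))\<^sup>2 / (2 * K) \<le> bregman f z y"
proof -
  define v where "v = gradient f y - gradient f z"
  define w where "w = y - (1 / K) *\<^sub>R v"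
  have lo: "f z + gradient f z \<bullet> (w - z) \<le> f w"
    by (rule convex_on_UNIV_imp_above_tangent[OF strongly_convex_imp_convex_on[OF f(1,2)]
      has_lipschitz_gradient_GDERIV[OF f(3)]])
  have up: "f w \<le> f y + gradient f y \<bullet> (w - y) + K / 2 * (norm (w - y))\<^sup>2"
    by (rule quadratic_upper_bound[OF f(3)])
  have "w - y = (- (1 / K)) *\<^sub>R v" by (simp add: w_def)
  then have n: "K / 2 * (norm (w - y))\<^sup>2 = (norm v)\<^sup>2 / (2 * K)"
    using K by (simp add: power_mult_distrib power2_eq_square)
  have "w - z = (w - y) + (y - z)" by simp
  then have "gradient f y \<bullet> (w - y) - gradient f z \<bullet> (w - z) = v \<bullet> (w - y) - gradient f z \<bullet> (y - z)"
    by (simp only: v_def inner_add_right inner_diff_left)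
  moreover have "v \<bullet> (w - y) = - (norm v)\<^sup>2 / K"
    by (simp add: \<open>w - y = _\<close> power2_norm_eq_inner)
  ultimately have i: "gradient f y \<bullet> (w - y) - gradient f z \<bullet> (w - z)
     = - (norm v)\<^sup>2 / K - gradient f z \<bullet> (y - z)"
    by simp
  have "(norm v)\<^sup>2 / K = 2 * ((norm v)\<^sup>2 / (2 * K))" by simp
  with lo up n i have "(norm v)\<^sup>2 / (2 * K) \<le> f y - f z - gradient f z \<bullet> (y - z)" by linarith
  then show ?thesis by (simp add: bregman_def v_def)
qed

text \<open>Strong convexity at \<open>x\<close> bounds \<open>f\<close> from below by a parabola of curvature \<open>\<mu>\<close>, smoothness at
  \<open>z\<close> bounds it from above by one of curvature \<open>K\<close>. The two are compared at the point \<open>z + p\<close> where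
  the upper one exceeds the lower one least, and its value is multiplied by \<open>(K - \<mu>) / K\<close>. This sharp
  form, with all three terms on the left, is what gives SAGA its rate.\<close>

lemma strong_cocoercivity:
  assumes f: "strongly_convex \<mu> f" "0 \<le> \<mu>" "has_lipschitz_gradient K f" and K: "\<mu> < K"
  shows "(1 - \<mu> / K) * bregman f z x + \<mu> / 2 * (norm (x - z))\<^sup>2
       + (norm (gradient f x - gradient f z))\<^sup>2 / (2 * K)
     \<le> (gradient f x - gradient f z) \<bullet> (x - z)"
proof -
  define u where "u = gradient f x - gradient f z"
  define e where "e = x - z"
  (* z + p is the point where the difference of the two parabolas is least. *)
  define p where "p = (1 / (K - \<mu>)) *\<^sub>R (u - \<mu> *\<^sub>R e)"
  have lo: "f x + gradient f x \<bullet> (z + p - x) + \<mu> / 2 * (norm (z + p - x))\<^sup>2 \<le> f (z + p)"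
    by (rule strongly_convex_above_tangent[OF f(1,2) has_lipschitz_gradient_GDERIV[OF f(3)]])
  have up: "f (z + p) \<le> f z + gradient f z \<bullet> (z + p - z) + K / 2 * (norm (z + p - z))\<^sup>2"
    by (rule quadratic_upper_bound[OF f(3)])
  have e: "z + p - x = p - e" by (simp add: e_def)
  have sq: "(norm (p - e))\<^sup>2 = (norm p)\<^sup>2 - 2 * (e \<bullet> p) + (norm e)\<^sup>2"
    by (simp add: power2_norm_eq_inner inner_diff_left inner_diff_right inner_commute)
  have "u \<bullet> (p - e) = gradient f x \<bullet> (p - e) - gradient f z \<bullet> p + gradient f z \<bullet> e"
    by (simp add: u_def inner_diff_left inner_diff_right)
  with lo up have "bregman f z x + u \<bullet> (p - e) + \<mu> / 2 * ((norm p)\<^sup>2 - 2 * (e \<bullet> p) + (norm e)\<^sup>2)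
      \<le> K / 2 * (norm p)\<^sup>2"
    unfolding e sq[symmetric] bregman_def e_def[symmetric] by simp
  then have "bregman f z x + u \<bullet> p - u \<bullet> e + \<mu> / 2 * ((norm p)\<^sup>2 - 2 * (e \<bullet> p) + (norm e)\<^sup>2)
      \<le> K / 2 * (norm p)\<^sup>2"
    by (simp add: inner_diff_right)
  then have "bregman f z x + (u - \<mu> *\<^sub>R e) \<bullet> p - (K - \<mu>) / 2 * (norm p)\<^sup>2
      \<le> u \<bullet> e - \<mu> / 2 * (norm e)\<^sup>2"
    by (simp add: inner_diff_left field_simps)
  moreover have "w \<bullet> ((1 / r) *\<^sub>R w) - r / 2 * (norm ((1 / r) *\<^sub>R w))\<^sup>2 = (norm w)\<^sup>2 / (2 * r)"
    if "0 < r" for r and w :: 'a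
    using that by (simp add: power_mult_distrib power_divide dot_square_norm field_simps power2_eq_square)
  then have "(u - \<mu> *\<^sub>R e) \<bullet> p - (K - \<mu>) / 2 * (norm p)\<^sup>2 = (norm (u - \<mu> *\<^sub>R e))\<^sup>2 / (2 * (K - \<mu>))"
    using K unfolding p_def by simp
  ultimately have "bregman f z x + (norm (u - \<mu> *\<^sub>R e))\<^sup>2 / (2 * (K - \<mu>)) \<le> u \<bullet> e - \<mu> / 2 * (norm e)\<^sup>2"
    by linarith
  then have "(K - \<mu>) * (bregman f z x + (norm (u - \<mu> *\<^sub>R e))\<^sup>2 / (2 * (K - \<mu>)))
     \<le> (K - \<mu>) * (u \<bullet> e - \<mu> / 2 * (norm e)\<^sup>2)"
    using K by (intro mult_left_mono) auto
  moreover have cancel: "r * (s / (2 * r)) = s / 2" if "0 < r" for r s :: real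
    using that by simp
  ultimately have A: "(K - \<mu>) * bregman f z x + (norm (u - \<mu> *\<^sub>R e))\<^sup>2 / 2
     \<le> (K - \<mu>) * (u \<bullet> e - \<mu> / 2 * (norm e)\<^sup>2)"
    using K cancel[of "K - \<mu>"] by (simp only: distrib_left)
  have W: "(norm (u - \<mu> *\<^sub>R e))\<^sup>2 = (norm u)\<^sup>2 - 2 * \<mu> * (u \<bullet> e) + \<mu>\<^sup>2 * (norm e)\<^sup>2"
    unfolding power2_norm_eq_inner
    by (simp add: inner_diff_left inner_diff_right inner_commute power2_eq_square algebra_simps)
  have lin: "r * B + K * (\<mu> / 2 * E) + U / 2 \<le> K * s"
    if "r * B + W / 2 \<le> r * (s - \<mu> / 2 * E)" "W = U - 2 * \<mu> * s + \<mu>\<^sup>2 * E" "K = r + \<mu>"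
    for r B W s E U :: real
    using that(1) unfolding that(2,3) by (simp add: field_simps power2_eq_square)
  have "(K - \<mu>) * bregman f z x + K * (\<mu> / 2 * (norm e)\<^sup>2) + (norm u)\<^sup>2 / 2 \<le> K * (u \<bullet> e)"
    by (rule lin[OF A W]) simp
  then have "((K - \<mu>) * bregman f z x + K * (\<mu> / 2 * (norm e)\<^sup>2) + (norm u)\<^sup>2 / 2) / K \<le> u \<bullet> e"
    using K f(2) by (simp add: pos_divide_le_eq mult.commute)
  moreover have "((K - \<mu>) * bregman f z x + K * (\<mu> / 2 * (norm e)\<^sup>2) + (norm u)\<^sup>2 / 2) / K
    = (1 - \<mu> / K) * bregman f z x + \<mu> / 2 * (norm e)\<^sup>2 + (norm u)\<^sup>2 / (2 * K)"
    using K f(2) by (simp add: field_simps)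
  ultimately show ?thesis by (simp add: u_def e_def)
qed

section \<open>Averaging over independent uniform indices\<close>

text \<open>Whatever a randomized algorithm has computed after \<open>t\<close> steps is such a function of its sequence of
  random choices. As each choice ranges over a finite set, it takes finitely many values, which removes
  all questions of measurability and integrability.\<close>

definition depends_on_first :: "nat \<Rightarrow> ((nat \<Rightarrow> 'b) \<Rightarrow> 'c) \<Rightarrow> bool" where
  "depends_on_first t y \<longleftrightarrow> (\<forall>js js'. (\<forall>s<t. js s = js' s) \<longrightarrow> y js = y js')"

locale iid_indices = prob_space M for M :: "'w measure" +
  fixes m :: nat and J :: "nat \<Rightarrow> 'w \<Rightarrow> nat"
  assumes m_pos: "0 < m"
    and indep: "indep_vars (\<lambda>_. count_space {1..m}) J UNIV"
    and uniform: "\<And>t. distr M (count_space {1..m}) (J t) = uniform_count_measure {1..m}"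
begin

abbreviation path :: "'w \<Rightarrow> nat \<Rightarrow> nat" where
  "path \<omega> \<equiv> \<lambda>s. J s \<omega>"

abbreviation histories :: "nat set \<Rightarrow> (nat \<Rightarrow> nat) set" where
  "histories A \<equiv> PiE A (\<lambda>_. {1..m})"

lemma measurable_index: "J t \<in> M \<rightarrow>\<^sub>M count_space {1..m}"
  using indep by (simp add: indep_vars_def)

lemma index_in: "\<omega> \<in> space M \<Longrightarrow> J t \<omega> \<in> {1..m}"
  using measurable_space[OF measurable_index] by (metis space_count_space)

lemma PiM_indices: "finite A \<Longrightarrow> PiM A (\<lambda>_. count_space {1..m}) = count_space (histories A)"
  by (rule count_space_PiM_finite) auto

lemma depends_on_first_restrict:
  assumes "depends_on_first t y"
  shows "y js = y (restrict js {..<t})"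
proof -
  have "\<forall>s<t. js s = restrict js {..<t} s" by simp
  then show ?thesis using assms unfolding depends_on_first_def by blast
qed

lemma integrable_history:
  fixes y :: "(nat \<Rightarrow> nat) \<Rightarrow> real"
  assumes y: "depends_on_first t y"
  shows "integrable M (\<lambda>\<omega>. y (path \<omega>))"
proof -
  let ?P = "histories {..<t}"
  have H: "(\<lambda>\<omega>. restrict (path \<omega>) {..<t}) \<in> M \<rightarrow>\<^sub>M count_space ?P"
    unfolding PiM_indices[OF finite_lessThan, symmetric]
    by (intro measurable_restrict measurable_index)
  have fin: "finite ?P" by (intro finite_PiE) auto
  have "integrable M (\<lambda>\<omega>. y (restrict (path \<omega>) {..<t}))"
  proof (rule integrable_const_bound)
    show "AE \<omega> in M. norm (y (restrict (path \<omega>) {..<t})) \<le> (\<Sum>h\<in>?P. \<bar>y h\<bar>)"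
    proof (rule AE_I2)
      fix \<omega> assume "\<omega> \<in> space M"
      then have mem: "restrict (path \<omega>) {..<t} \<in> ?P" using index_in by (auto simp: restrict_PiE_iff)
      show "norm (y (restrict (path \<omega>) {..<t})) \<le> (\<Sum>h\<in>?P. \<bar>y h\<bar>)"
        using member_le_sum[OF mem _ fin, of "\<lambda>h. \<bar>y h\<bar>"] by simp
    qed
    show "(\<lambda>\<omega>. y (restrict (path \<omega>) {..<t})) \<in> borel_measurable M"
      by (rule measurable_compose[OF H]) simp
  qed
  moreover have "(\<lambda>\<omega>. y (path \<omega>)) = (\<lambda>\<omega>. y (restrict (path \<omega>) {..<t}))"
    by (rule ext) (rule depends_on_first_restrict[OF y])
  ultimately show ?thesis by simp
qed

lemma prob_index: "j \<in> {1..m} \<Longrightarrow> expectation (\<lambda>\<omega>. indicator {j} (J t \<omega>)) = 1 / m"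
proof -
  assume j: "j \<in> {1..m}"
  have "expectation (\<lambda>\<omega>. indicator {j} (J t \<omega>) :: real)
      = integral\<^sup>L (distr M (count_space {1..m}) (J t)) (indicator {j})"
    by (rule integral_distr[OF measurable_index, symmetric]) simp
  also have "\<dots> = (\<Sum>i\<in>{1..m}. indicator {j} i) / m"
    unfolding uniform by (simp only: integral_uniform_count_measure finite_atLeastAtMost card_atLeastAtMost) simp
  also have "(\<Sum>i\<in>{1..m}. indicator {j} i :: real) = 1"
    using j by (simp add: indicator_def)
  finally show ?thesis .
qed

text \<open>Independence in the only form that the analysis needs, as a substitute for conditional expectations:
  the next index may be replaced by the average over its values. The proof splits according to the value
  \<open>j\<close> of the index; the indicator of that event is independent of the history.\<close>

lemma expectation_average_next_index:
  fixes k :: "nat \<Rightarrow> (nat \<Rightarrow> nat) \<Rightarrow> real"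
  assumes k: "\<And>j. j \<in> {1..m} \<Longrightarrow> depends_on_first t (k j)"
  shows "expectation (\<lambda>\<omega>. k (J t \<omega>) (path \<omega>))
       = expectation (\<lambda>\<omega>. (\<Sum>j=1..m. k j (path \<omega>)) / m)"
proof -
  have one: "expectation (\<lambda>\<omega>. k j (path \<omega>) * indicator {j} (J t \<omega>)) = expectation (\<lambda>\<omega>. k j (path \<omega>)) / m"
    and int: "integrable M (\<lambda>\<omega>. k j (path \<omega>) * indicator {j} (J t \<omega>))"
    if j: "j \<in> {1..m}" for j
  proof -
    have restr: "(\<lambda>\<omega>. k j (restrict (path \<omega>) {..<t})) = (\<lambda>\<omega>. k j (path \<omega>))"
      by (rule ext) (rule depends_on_first_restrict[OF k[OF j], symmetric])
    have "indep_var (PiM {..<t} (\<lambda>_. count_space {1..m})) (\<lambda>\<omega>. restrict (path \<omega>) {..<t})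
          (PiM {t} (\<lambda>_. count_space {1..m})) (\<lambda>\<omega>. restrict (path \<omega>) {t})"
      by (rule indep_var_restrict[OF indep]) auto
    then have "indep_var borel (k j \<circ> (\<lambda>\<omega>. restrict (path \<omega>) {..<t}))
          borel ((\<lambda>h. indicator {j} (h t) :: real) \<circ> (\<lambda>\<omega>. restrict (path \<omega>) {t}))"
      by (rule indep_var_compose)
        (unfold PiM_indices[OF finite_lessThan] PiM_indices[OF finite.insertI[OF finite.emptyI]], simp_all)
    then have ind: "indep_var borel (\<lambda>\<omega>. k j (path \<omega>)) borel (\<lambda>\<omega>. indicator {j} (J t \<omega>) :: real)"
      by (simp add: comp_def restr)
    have i1: "integrable M (\<lambda>\<omega>. k j (path \<omega>))"
      by (rule integrable_history[OF k[OF j]])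
    have i2: "integrable M (\<lambda>\<omega>. indicator {j} (path \<omega> t) :: real)"
      by (rule integrable_history[of "Suc t"]) (simp add: depends_on_first_def)
    show "integrable M (\<lambda>\<omega>. k j (path \<omega>) * indicator {j} (J t \<omega>))"
      by (rule indep_var_integrable[OF ind i1 i2])
    show "expectation (\<lambda>\<omega>. k j (path \<omega>) * indicator {j} (J t \<omega>)) = expectation (\<lambda>\<omega>. k j (path \<omega>)) / m"
      using indep_var_lebesgue_integral[OF ind i1 i2] prob_index[OF j] by simp
  qed
  have "expectation (\<lambda>\<omega>. k (J t \<omega>) (path \<omega>))
      = expectation (\<lambda>\<omega>. \<Sum>j=1..m. k j (path \<omega>) * indicator {j} (J t \<omega>))"
  proof (rule Bochner_Integration.integral_cong[OF refl])
    fix \<omega> assume "\<omega> \<in> space M"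
    then have "J t \<omega> \<in> {1..m}" by (rule index_in)
    then show "k (J t \<omega>) (path \<omega>) = (\<Sum>j=1..m. k j (path \<omega>) * indicator {j} (J t \<omega>))"
      by (simp add: indicator_def)
  qed
  also have "\<dots> = (\<Sum>j=1..m. expectation (\<lambda>\<omega>. k j (path \<omega>)) / m)"
    using int one by (subst Bochner_Integration.integral_sum) auto
  also have "\<dots> = expectation (\<lambda>\<omega>. (\<Sum>j=1..m. k j (path \<omega>)) / m)"
    using integrable_history[OF k] by (simp add: Bochner_Integration.integral_sum sum_divide_distrib)
  finally show ?thesis .
qed

end

section \<open>The potential of the SAGA recursion\<close>

definition saga_step ::
  "(nat \<Rightarrow> 'a::euclidean_space \<Rightarrow> real) \<Rightarrow> nat \<Rightarrow> real \<Rightarrow> 'a \<times> (nat \<Rightarrow> 'a) \<Rightarrow> nat \<Rightarrow> 'a \<times> (nat \<Rightarrow> 'a)" where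
  "saga_step g m \<alpha> st j = (case st of (x, \<phi>) \<Rightarrow>
     (x - \<alpha> *\<^sub>R (gradient (g j) x - gradient (g j) (\<phi> j)
         + (1 / real m) *\<^sub>R (\<Sum>i=1..m. gradient (g i) (\<phi> i))), \<phi>(j := x)))"

lemma saga_state_Suc_step:
  "saga_state g m \<alpha> x0 js (Suc t) = saga_step g m \<alpha> (saga_state g m \<alpha> x0 js t) (js t)"
  by (simp add: saga_step_def Let_def split: prod.split)

lemma depends_on_first_saga_state:
  "depends_on_first t (\<lambda>js. saga_state g m \<alpha> x0 js t)"
proof (induction t)
  case 0
  show ?case by (simp add: depends_on_first_def)
next
  case (Suc t)
  show ?case unfolding depends_on_first_def
  proof (intro allI impI)
    fix js js' :: "nat \<Rightarrow> nat" assume "\<forall>s<Suc t. js s = js' s"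
    then have "saga_state g m \<alpha> x0 js t = saga_state g m \<alpha> x0 js' t" "js t = js' t"
      using Suc unfolding depends_on_first_def by auto
    then show "saga_state g m \<alpha> x0 js (Suc t) = saga_state g m \<alpha> x0 js' (Suc t)"
      by (simp only: saga_state_Suc_step)
  qed
qed

lemma depends_on_first_saga_iterate:
  assumes "k \<le> t"
  shows "depends_on_first t (\<lambda>js. saga_iterate g m \<alpha> x0 js k)"
  using depends_on_first_saga_state[of k g m \<alpha> x0] assms
  unfolding depends_on_first_def saga_iterate_def by (metis order.strict_trans2)

lemma depends_on_first_compose:
  "depends_on_first t y \<Longrightarrow> depends_on_first t (\<lambda>js. h (y js))"
  unfolding depends_on_first_def by metis

text \<open>An average of \<open>m\<close> functions, each \<open>\<mu>\<close>-strongly convex with a \<open>K\<close>-Lipschitz gradient,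
  together with a minimizer \<open>z\<close>; merely convex functions are the case \<open>\<mu> = 0\<close>.\<close>

locale finite_sum =
  fixes g :: "nat \<Rightarrow> 'a::euclidean_space \<Rightarrow> real" and m :: nat and \<mu> K :: real and z :: 'a
  assumes m_pos: "0 < m" and mu_nonneg: "0 \<le> \<mu>" and mu_less: "\<mu> < K"
    and strong: "\<And>i. i \<in> {1..m} \<Longrightarrow> strongly_convex \<mu> (g i)"
    and smooth: "\<And>i. i \<in> {1..m} \<Longrightarrow> has_lipschitz_gradient K (g i)"
    and minimizer: "\<And>y. (\<Sum>i=1..m. g i z) \<le> (\<Sum>i=1..m. g i y)"
begin

definition avg :: "(nat \<Rightarrow> 'b) \<Rightarrow> 'b::real_vector" where
  "avg h = (1 / real m) *\<^sub>R (\<Sum>i=1..m. h i)"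

lemma avg_const [simp]: "avg (\<lambda>i. x) = (x :: 'b::real_vector)"
  using m_pos by (simp add: avg_def sum_constant_scaleR)

lemma avg_add: "avg (\<lambda>i. h i + k i) = avg h + avg k"
  by (simp add: avg_def sum.distrib scaleR_add_right)

lemma avg_diff: "avg (\<lambda>i. h i - k i) = avg h - avg k"
  by (simp add: avg_def sum_subtractf scaleR_diff_right)

lemma avg_scaleR: "avg (\<lambda>i. r *\<^sub>R h i) = r *\<^sub>R avg h"
  by (simp add: avg_def scaleR_sum_right[symmetric])

lemma avg_mult: "avg (\<lambda>i. r * h i) = r * (avg h :: real)"
  using avg_scaleR[of r h] by simp

lemma avg_inner: "avg (\<lambda>i. h i \<bullet> w) = avg h \<bullet> w"
  by (simp add: avg_def inner_sum_left)

lemma avg_inner_right: "avg (\<lambda>i. w \<bullet> h i) = w \<bullet> avg h"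
  using avg_inner[of h w] by (simp add: inner_commute)

lemma avg_mono: "(\<And>i. i \<in> {1..m} \<Longrightarrow> h i \<le> (k i :: real)) \<Longrightarrow> avg h \<le> avg k"
  by (auto simp: avg_def intro!: divide_right_mono sum_mono)

lemma avg_nonneg: "(\<And>i. i \<in> {1..m} \<Longrightarrow> 0 \<le> (k i :: real)) \<Longrightarrow> 0 \<le> avg k"
  using avg_mono[of "\<lambda>_. 0" k] by simp

lemma K_pos: "0 < K" using mu_nonneg mu_less by simp

text \<open>Otherwise a step of length \<open>1 / K\<close> against the averaged gradient would decrease the objective.\<close>

lemma avg_gradient_minimizer: "avg (\<lambda>i. gradient (g i) z) = 0"
proof -
  define v where "v = avg (\<lambda>i. gradient (g i) z)"
  let ?y = "z - (1 / K) *\<^sub>R v"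
  have "avg (\<lambda>i. g i z) \<le> avg (\<lambda>i. g i ?y)"
    using minimizer by (simp add: avg_def divide_right_mono)
  also have "\<dots> \<le> avg (\<lambda>i. g i z + gradient (g i) z \<bullet> (?y - z) + K / 2 * (norm (?y - z))\<^sup>2)"
    by (intro avg_mono quadratic_upper_bound smooth)
  also have "\<dots> = avg (\<lambda>i. g i z) + v \<bullet> (?y - z) + K / 2 * (norm (?y - z))\<^sup>2"
    by (simp only: avg_add avg_inner avg_const v_def)
  also have "v \<bullet> (?y - z) = - (2 * ((norm v)\<^sup>2 / (2 * K)))"
    by (simp add: power2_norm_eq_inner)
  also have "K / 2 * (norm (?y - z))\<^sup>2 = (norm v)\<^sup>2 / (2 * K)"
    using K_pos by (simp add: power_divide power2_eq_square)
  finally have "(norm v)\<^sup>2 / (2 * K) \<le> 0" by linarith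
  then show ?thesis using K_pos unfolding v_def[symmetric] by (simp add: divide_le_0_iff)
qed

definition gap :: "'a \<Rightarrow> real" where
  "gap x = avg (\<lambda>i. g i x) - avg (\<lambda>i. g i z)"

text \<open>The linear terms of the Bregman divergences cancel on average, since the gradients at \<open>z\<close>
  average to zero.\<close>

lemma gap_eq_avg_bregman: "gap x = avg (\<lambda>i. bregman (g i) z x)"
  using avg_gradient_minimizer
  by (simp add: gap_def bregman_def avg_diff avg_inner)

lemma gap_nonneg: "0 \<le> gap x"
  unfolding gap_eq_avg_bregman by (intro avg_nonneg bregman_nonneg[OF strong mu_nonneg smooth])

text \<open>The Polyak-Lojasiewicz inequality, by completing the square in the strong convexity bound from \<open>x\<close>
  to \<open>z\<close>.\<close>

lemma gap_le_norm_gradient: "2 * \<mu> * gap x \<le> (norm (avg (\<lambda>i. gradient (g i) x)))\<^sup>2"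
proof -
  define w where "w = avg (\<lambda>i. gradient (g i) x)"
  have "avg (\<lambda>i. g i x + gradient (g i) x \<bullet> (z - x) + \<mu> / 2 * (norm (z - x))\<^sup>2) \<le> avg (\<lambda>i. g i z)"
    by (intro avg_mono strongly_convex_above_tangent[OF strong mu_nonneg]
        has_lipschitz_gradient_GDERIV[OF smooth])
  then have "avg (\<lambda>i. g i x) + w \<bullet> (z - x) + \<mu> / 2 * (norm (z - x))\<^sup>2 \<le> avg (\<lambda>i. g i z)"
    by (simp only: avg_add avg_inner avg_const w_def)
  then have "gap x \<le> - (w \<bullet> (z - x)) - \<mu> / 2 * (norm (z - x))\<^sup>2"
    unfolding gap_def by linarith
  then have "2 * \<mu> * gap x \<le> 2 * \<mu> * (- (w \<bullet> (z - x)) - \<mu> / 2 * (norm (z - x))\<^sup>2)"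
    using mu_nonneg by (intro mult_left_mono) auto
  also have "\<dots> = (norm w)\<^sup>2 - (norm (w + \<mu> *\<^sub>R (z - x)))\<^sup>2"
    unfolding power2_norm_eq_inner
    by (simp add: inner_add_left inner_add_right inner_diff_left inner_diff_right inner_commute
        power2_eq_square algebra_simps)
  also have "\<dots> \<le> (norm w)\<^sup>2" by simp
  finally show ?thesis by (simp add: w_def)
qed

lemma avg_variance:
  fixes u :: "nat \<Rightarrow> 'a"
  shows "avg (\<lambda>i. (norm (u i - avg u))\<^sup>2) = avg (\<lambda>i. (norm (u i))\<^sup>2) - (norm (avg u))\<^sup>2"
proof -
  have "(norm (u i - avg u))\<^sup>2 = (norm (u i))\<^sup>2 - 2 * (u i \<bullet> avg u) + (norm (avg u))\<^sup>2" for i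
    unfolding power2_norm_eq_inner by (simp add: inner_diff_left inner_diff_right inner_commute)
  then show ?thesis
    by (simp add: avg_add avg_diff avg_mult avg_inner power2_norm_eq_inner)
qed

lemma norm_diff_square_le:
  fixes p r :: 'a
  assumes "0 < s"
  shows "(norm (p - r))\<^sup>2 \<le> (1 + s) * (norm p)\<^sup>2 + (1 + 1 / s) * (norm r)\<^sup>2"
proof -
  have "0 \<le> (norm (s *\<^sub>R p + r))\<^sup>2 / s" using assms by simp
  also have "\<dots> = s * (norm p)\<^sup>2 + 2 * (p \<bullet> r) + (1 / s) * (norm r)\<^sup>2"
    using assms unfolding power2_norm_eq_inner
    by (simp add: inner_add_left inner_add_right inner_commute field_simps)
  finally have "- (2 * (p \<bullet> r)) \<le> s * (norm p)\<^sup>2 + (1 / s) * (norm r)\<^sup>2" by linarith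
  moreover have "(norm (p - r))\<^sup>2 = (norm p)\<^sup>2 - 2 * (p \<bullet> r) + (norm r)\<^sup>2"
    unfolding power2_norm_eq_inner by (simp add: inner_diff_left inner_diff_right inner_commute)
  ultimately show ?thesis by (simp add: distrib_right)
qed

text \<open>Here \<open>u j\<close> and \<open>v j\<close> stand for the gradients of the \<open>j\<close>-th component at the iterate and at its
  table entry, relative to the gradient at \<open>z\<close>, so the left side is the second moment of the search
  direction. Centring both families first and only then applying Young's inequality with weight \<open>s\<close>
  leaves the negative multiple of the squared mean, which the strongly convex rate relies on.\<close>

lemma avg_variance_reduced_direction:
  fixes u v :: "nat \<Rightarrow> 'a"
  assumes "0 < s"
  shows "avg (\<lambda>j. (norm (u j - v j + avg v))\<^sup>2)
    \<le> (1 + s) * avg (\<lambda>j. (norm (u j))\<^sup>2) - s * (norm (avg u))\<^sup>2 + (1 + 1 / s) * avg (\<lambda>j. (norm (v j))\<^sup>2)"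
proof -
  let ?p = "\<lambda>j. u j - avg u" and ?r = "\<lambda>j. v j - avg v"
  have "avg (\<lambda>j. (norm (u j - v j + avg v))\<^sup>2)
    \<le> avg (\<lambda>j. (norm (avg u))\<^sup>2 + 2 * (avg u \<bullet> (?p j - ?r j))
         + ((1 + s) * (norm (?p j))\<^sup>2 + (1 + 1 / s) * (norm (?r j))\<^sup>2))"
  proof (rule avg_mono)
    fix j
    have "u j - v j + avg v = avg u + (?p j - ?r j)" by simp
    then have "(norm (u j - v j + avg v))\<^sup>2
      = (norm (avg u))\<^sup>2 + 2 * (avg u \<bullet> (?p j - ?r j)) + (norm (?p j - ?r j))\<^sup>2"
      unfolding power2_norm_eq_inner by (simp only: inner_add_left inner_add_right inner_commute)
    with norm_diff_square_le[OF assms, of "?p j" "?r j"]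
    show "(norm (u j - v j + avg v))\<^sup>2 \<le> (norm (avg u))\<^sup>2 + 2 * (avg u \<bullet> (?p j - ?r j))
         + ((1 + s) * (norm (?p j))\<^sup>2 + (1 + 1 / s) * (norm (?r j))\<^sup>2)" by linarith
  qed
  also have "\<dots> = (norm (avg u))\<^sup>2 + (1 + s) * (avg (\<lambda>j. (norm (u j))\<^sup>2) - (norm (avg u))\<^sup>2)
      + (1 + 1 / s) * (avg (\<lambda>j. (norm (v j))\<^sup>2) - (norm (avg v))\<^sup>2)"
    by (simp add: avg_add avg_diff avg_mult avg_inner_right avg_variance)
  also have "\<dots> \<le> (1 + s) * avg (\<lambda>j. (norm (u j))\<^sup>2) - s * (norm (avg u))\<^sup>2 + (1 + 1 / s) * avg (\<lambda>j. (norm (v j))\<^sup>2)"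
    using assms by (simp add: algebra_simps)
  finally show ?thesis .
qed

definition table_error :: "(nat \<Rightarrow> 'a) \<Rightarrow> real" where
  "table_error \<phi> = avg (\<lambda>i. bregman (g i) z (\<phi> i))"

text \<open>The Lyapunov function of SAGA. The table error controls the variance of the search direction and the
  distance term makes progress proportional to the gap; \<open>c\<close> balances them.\<close>

definition potential :: "real \<Rightarrow> 'a \<times> (nat \<Rightarrow> 'a) \<Rightarrow> real" where
  "potential c st = table_error (snd st) + c * (norm (fst st - z))\<^sup>2"

lemma table_error_nonneg: "0 \<le> table_error \<phi>"
  unfolding table_error_def by (intro avg_nonneg bregman_nonneg[OF strong mu_nonneg smooth])

lemma potential_nonneg: "0 \<le> c \<Longrightarrow> 0 \<le> potential c st"
  unfolding potential_def using table_error_nonneg by simp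

text \<open>A uniformly chosen entry is replaced by the current iterate, and the mean divergence at the iterate is
  the gap.\<close>

lemma avg_table_error_update:
  "avg (\<lambda>j. table_error (\<phi>(j := x))) = table_error \<phi> + gap x / m - table_error \<phi> / m"
proof -
  let ?B = "\<lambda>i. bregman (g i) z"
  have "table_error (\<phi>(j := x)) = table_error \<phi> + (?B j x - ?B j (\<phi> j)) / m"
    if j: "j \<in> {1..m}" for j
  proof -
    have "(\<Sum>i=1..m. ?B i ((\<phi>(j := x)) i))
        = (\<Sum>i=1..m. ?B i (\<phi> i) + (if i = j then ?B j x - ?B j (\<phi> j) else 0))"
      by (intro sum.cong) auto
    also have "\<dots> = (\<Sum>i=1..m. ?B i (\<phi> i)) + (?B j x - ?B j (\<phi> j))"
      using j by (simp add: sum.distrib)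
    finally show ?thesis by (simp add: table_error_def avg_def add_divide_distrib)
  qed
  then have "avg (\<lambda>j. table_error (\<phi>(j := x))) = avg (\<lambda>j. table_error \<phi> + (1 / m) * (?B j x - ?B j (\<phi> j)))"
    by (simp add: avg_def)
  also have "\<dots> = table_error \<phi> + gap x / m - table_error \<phi> / m"
    by (simp only: avg_add avg_const avg_mult avg_diff gap_eq_avg_bregman table_error_def)
      (simp add: diff_divide_distrib)
  finally show ?thesis .
qed

lemma avg_distance_step:
  fixes u v :: "nat \<Rightarrow> 'a"
  assumes s: "0 < s"
  shows "avg (\<lambda>j. (norm (x - \<alpha> *\<^sub>R (u j - v j + avg v) - z))\<^sup>2)
    \<le> (norm (x - z))\<^sup>2 - 2 * \<alpha> * (avg u \<bullet> (x - z))
      + \<alpha>\<^sup>2 * ((1 + s) * avg (\<lambda>j. (norm (u j))\<^sup>2) - s * (norm (avg u))\<^sup>2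
          + (1 + 1 / s) * avg (\<lambda>j. (norm (v j))\<^sup>2))"
proof -
  let ?w = "\<lambda>j. u j - v j + avg v"
  have "(norm (x - \<alpha> *\<^sub>R w - z))\<^sup>2
      = (norm (x - z))\<^sup>2 - 2 * \<alpha> * (w \<bullet> (x - z)) + \<alpha>\<^sup>2 * (norm w)\<^sup>2" for w
    unfolding power2_norm_eq_inner
    by (simp add: inner_diff_left inner_diff_right inner_commute power2_eq_square algebra_simps)
  then have "avg (\<lambda>j. (norm (x - \<alpha> *\<^sub>R ?w j - z))\<^sup>2)
    = (norm (x - z))\<^sup>2 - 2 * \<alpha> * (avg ?w \<bullet> (x - z)) + \<alpha>\<^sup>2 * avg (\<lambda>j. (norm (?w j))\<^sup>2)"
    by (simp only: avg_add avg_diff avg_mult avg_inner avg_const)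
  moreover have "avg ?w = avg u" by (simp add: avg_add avg_diff)
  moreover have "\<alpha>\<^sup>2 * avg (\<lambda>j. (norm (?w j))\<^sup>2) \<le> \<alpha>\<^sup>2 * ((1 + s) * avg (\<lambda>j. (norm (u j))\<^sup>2)
      - s * (norm (avg u))\<^sup>2 + (1 + 1 / s) * avg (\<lambda>j. (norm (v j))\<^sup>2))"
    by (intro mult_left_mono avg_variance_reduced_direction s) simp
  ultimately show ?thesis by simp
qed

text \<open>All that is specific to the functions is used up here, so that the rates below follow by choosing
  \<open>\<alpha>\<close>, \<open>c\<close> and \<open>s\<close>. The number \<open>U\<close> is the mean squared gradient difference at the iterate; it
  is left unspecified because both choices make its coefficient vanish.\<close>

lemma avg_potential_step:
  assumes s: "0 < s" and c: "0 \<le> c" and \<alpha>: "0 \<le> \<alpha>"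
  obtains U where "0 \<le> U"
    and "avg (\<lambda>j. potential c (saga_step g m \<alpha> (x, \<phi>) j))
      \<le> table_error \<phi> + c * (norm (x - z))\<^sup>2 + gap x / m - table_error \<phi> / m
        - 2 * (c * \<alpha>) * ((1 - \<mu> / K) * gap x + \<mu> / 2 * (norm (x - z))\<^sup>2 + U / (2 * K))
        + c * \<alpha>\<^sup>2 * ((1 + s) * U - s * (2 * \<mu> * gap x) + (1 + 1 / s) * (2 * K * table_error \<phi>))"
proof -
  define u v where "u j = gradient (g j) x - gradient (g j) z"
    and "v j = gradient (g j) (\<phi> j) - gradient (g j) z" for j
  define U W where "U = avg (\<lambda>j. (norm (u j))\<^sup>2)" and "W = avg (\<lambda>j. (norm (v j))\<^sup>2)"
  have avg_u: "avg u = avg (\<lambda>j. gradient (g j) x)" and avg_v: "avg v = avg (\<lambda>j. gradient (g j) (\<phi> j))"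
    using avg_gradient_minimizer by (simp_all add: u_def[abs_def] v_def[abs_def] avg_diff)
  have step: "saga_step g m \<alpha> (x, \<phi>) j = (x - \<alpha> *\<^sub>R (u j - v j + avg v), \<phi>(j := x))" for j
    by (simp add: saga_step_def avg_v) (simp add: u_def v_def avg_def)
  have W: "W \<le> 2 * K * table_error \<phi>"
  proof -
    have "W \<le> avg (\<lambda>i. 2 * K * bregman (g i) z (\<phi> i))"
      unfolding W_def
    proof (rule avg_mono)
      fix i assume "i \<in> {1..m}"
      from bregman_ge_gradient_diff[OF strong[OF this] mu_nonneg smooth[OF this] K_pos, of "\<phi> i" z]
      show "(norm (v i))\<^sup>2 \<le> 2 * K * bregman (g i) z (\<phi> i)"
        using K_pos by (simp add: v_def pos_divide_le_eq mult.commute)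
    qed
    then show ?thesis by (simp only: avg_mult table_error_def)
  qed
  have I: "(1 - \<mu> / K) * gap x + \<mu> / 2 * (norm (x - z))\<^sup>2 + U / (2 * K) \<le> avg u \<bullet> (x - z)"
  proof -
    have "avg (\<lambda>i. (1 - \<mu> / K) * bregman (g i) z x + \<mu> / 2 * (norm (x - z))\<^sup>2 + 1 / (2 * K) * (norm (u i))\<^sup>2)
       \<le> avg (\<lambda>i. u i \<bullet> (x - z))"
    proof (rule avg_mono)
      fix i assume "i \<in> {1..m}"
      from strong_cocoercivity[OF strong[OF this] mu_nonneg smooth[OF this] mu_less, of z x]
      show "(1 - \<mu> / K) * bregman (g i) z x + \<mu> / 2 * (norm (x - z))\<^sup>2 + 1 / (2 * K) * (norm (u i))\<^sup>2
         \<le> u i \<bullet> (x - z)" by (simp add: u_def)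
    qed
    then show ?thesis
      by (simp only: avg_add avg_mult avg_inner avg_const gap_eq_avg_bregman U_def) simp
  qed
  have N: "2 * \<mu> * gap x \<le> (norm (avg u))\<^sup>2"
    using gap_le_norm_gradient avg_u by simp
  have "avg (\<lambda>j. potential c (saga_step g m \<alpha> (x, \<phi>) j))
    = avg (\<lambda>j. table_error (\<phi>(j := x))) + c * avg (\<lambda>j. (norm (x - \<alpha> *\<^sub>R (u j - v j + avg v) - z))\<^sup>2)"
    by (simp only: potential_def step fst_conv snd_conv avg_add avg_mult)
  also have "\<dots> \<le> (table_error \<phi> + gap x / m - table_error \<phi> / m)
      + c * ((norm (x - z))\<^sup>2 - 2 * \<alpha> * (avg u \<bullet> (x - z))
        + \<alpha>\<^sup>2 * ((1 + s) * U - s * (norm (avg u))\<^sup>2 + (1 + 1 / s) * W))"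
    unfolding avg_table_error_update U_def W_def
    by (intro add_left_mono mult_left_mono avg_distance_step s c)
  also have "\<dots> \<le> (table_error \<phi> + gap x / m - table_error \<phi> / m)
      + c * ((norm (x - z))\<^sup>2 - 2 * \<alpha> * ((1 - \<mu> / K) * gap x + \<mu> / 2 * (norm (x - z))\<^sup>2 + U / (2 * K))
        + \<alpha>\<^sup>2 * ((1 + s) * U - s * (2 * \<mu> * gap x) + (1 + 1 / s) * (2 * K * table_error \<phi>)))"
    using I N W s \<alpha> c
    by (intro add_left_mono mult_left_mono add_mono diff_mono order.refl) auto
  finally have "avg (\<lambda>j. potential c (saga_step g m \<alpha> (x, \<phi>) j)) \<le> \<dots>" .
  moreover have "0 \<le> U" unfolding U_def by (intro avg_nonneg) simp
  ultimately show ?thesis using that[of U] by (simp add: algebra_simps)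
qed

end

section \<open>Convergence rates of SAGA\<close>

text \<open>The conditions on step size \<open>\<alpha>\<close> and Young weight \<open>s\<close> under which the coefficients in
  \<open>avg_potential_step\<close> have the right signs. With \<open>r = \<mu> * n\<close> the last one reduces to
  \<open>4 * K * (r + K)\<^sup>2 \<le> (r + 2 * K)\<^sup>2 * (2 * r + K)\<close>, which is seen by expanding.\<close>

lemma saga_step_size_inequality:
  fixes \<mu> K \<alpha> s n :: real
  assumes "0 \<le> \<mu>" "0 < K" "1 \<le> n"
    and \<alpha>: "\<alpha> = 1 / (2 * (\<mu> * n + K))" and s: "s = (2 * \<mu> * n + K) / K"
  shows "(1 + s) * \<alpha> = 1 / K" "\<alpha> * n * \<mu> \<le> 1 / 2"
    and "K * \<alpha> * (1 + 1 / s) \<le> (1 - \<alpha> * \<mu>) * (1 - \<alpha> * n * \<mu>)"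
proof -
  define r where "r = \<mu> * n"
  have r: "0 \<le> r" "\<mu> \<le> r" using assms mult_left_mono[of 1 n \<mu>] by (auto simp: r_def)
  have pos: "0 < r + K" "0 < 2 * r + K" using r assms by auto
  show eq: "(1 + s) * \<alpha> = 1 / K"
  proof -
    have "1 + s = 2 * (r + K) / K" using \<open>0 < K\<close> by (simp add: s r_def mult.assoc field_simps)
    then show ?thesis using pos by (simp add: \<alpha> r_def)
  qed
  have ar: "\<alpha> * n * \<mu> = r / (2 * (r + K))" by (simp add: \<alpha> r_def mult.commute)
  show "\<alpha> * n * \<mu> \<le> 1 / 2" unfolding ar using pos \<open>0 < K\<close> by (simp add: pos_divide_le_eq)
  have a0: "0 \<le> \<alpha>" using pos by (simp add: \<alpha> r_def)
  have one_minus: "1 - \<alpha> * n * \<mu> = (r + 2 * K) / (2 * (r + K))"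
    unfolding ar using pos by (simp add: field_simps)
  have "K * \<alpha> * (1 + 1 / s) = K / (2 * r + K)"
  proof -
    have "s = (2 * r + K) / K" by (simp add: s r_def mult.assoc)
    then have "1 + 1 / s = 1 + K / (2 * r + K)" by simp
    also have "\<dots> = 2 * (r + K) / (2 * r + K)" using pos \<open>0 < K\<close> by (simp add: field_simps)
    finally show ?thesis using pos by (simp add: \<alpha> r_def)
  qed
  also have "\<dots> \<le> ((r + 2 * K) / (2 * (r + K)))\<^sup>2"
  proof -
    have "(r + 2 * K)\<^sup>2 * (2 * r + K) - K * (2 * (r + K))\<^sup>2 = 2 * r ^ 3 + 5 * r\<^sup>2 * K + 4 * r * K\<^sup>2"
      by (simp add: power2_eq_square power3_eq_cube algebra_simps)
    also have "\<dots> \<ge> 0" using r \<open>0 < K\<close> by simp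
    finally have "K * (2 * (r + K))\<^sup>2 \<le> (r + 2 * K)\<^sup>2 * (2 * r + K)" by simp
    then show ?thesis
      using pos by (simp add: power_divide divide_le_eq pos_le_divide_eq)
  qed
  also have "\<dots> = (1 - \<alpha> * n * \<mu>) * (1 - \<alpha> * n * \<mu>)" by (simp add: one_minus power2_eq_square)
  also have "\<dots> \<le> (1 - \<alpha> * \<mu>) * (1 - \<alpha> * n * \<mu>)"
  proof (rule mult_right_mono)
    have "\<alpha> * \<mu> \<le> \<alpha> * r" using r a0 by (intro mult_left_mono)
    then show "1 - \<alpha> * n * \<mu> \<le> 1 - \<alpha> * \<mu>" by (simp add: r_def mult.commute mult.left_commute)
    show "0 \<le> 1 - \<alpha> * n * \<mu>" unfolding one_minus using r \<open>0 < K\<close> by simp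
  qed
  finally show "K * \<alpha> * (1 + 1 / s) \<le> (1 - \<alpha> * \<mu>) * (1 - \<alpha> * n * \<mu>)" .
qed

context finite_sum
begin

text \<open>The weight \<open>s = (2 * \<mu> * m + K) / K\<close> cancels the term in \<open>U\<close>; then \<open>c\<close> is chosen so that the gap
  cancels too. What remains is a condition on the coefficient of the table error, which is the last
  inequality of \<open>saga_step_size_inequality\<close>.\<close>

lemma potential_contraction:
  fixes \<alpha> c :: real
  defines "\<alpha> \<equiv> 1 / (2 * (\<mu> * m + K))" and "c \<equiv> 1 / (2 * \<alpha> * (1 - \<alpha> * \<mu>) * m)"
  shows "avg (\<lambda>j. potential c (saga_step g m \<alpha> st j)) \<le> (1 - \<alpha> * \<mu>) * potential c st"
    and "0 < c" and "0 < 1 - \<alpha> * \<mu>"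
proof -
  obtain x \<phi> where st: "st = (x, \<phi>)" by (cases st)
  define s where "s = (2 * \<mu> * m + K) / K"
  have m1: "1 \<le> real m" using m_pos by simp
  note ineq = saga_step_size_inequality[OF mu_nonneg K_pos m1 meta_eq_to_obj_eq[OF \<alpha>_def] s_def]
  have den: "0 < \<mu> * m + K" using mu_nonneg K_pos by (simp add: add_nonneg_pos)
  then have a: "0 < \<alpha>" by (simp add: \<alpha>_def)
  have s: "0 < s" using mu_nonneg K_pos by (simp add: s_def add_nonneg_pos)
  have "\<alpha> * \<mu> \<le> \<alpha> * m * \<mu>"
    using a mu_nonneg m1 mult_left_mono[of 1 m "\<alpha> * \<mu>"] by (simp add: mult.commute mult.left_commute)
  then show q: "0 < 1 - \<alpha> * \<mu>" using ineq(2) by linarith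
  then show c: "0 < c" using a m_pos by (simp add: c_def)
  have ca: "2 * (c * \<alpha>) * (1 - \<alpha> * \<mu>) = 1 / m"
    using a q m_pos unfolding c_def by simp
  obtain U where U: "0 \<le> U"
    and step: "avg (\<lambda>j. potential c (saga_step g m \<alpha> (x, \<phi>) j))
      \<le> table_error \<phi> + c * (norm (x - z))\<^sup>2 + gap x / m - table_error \<phi> / m
        - 2 * (c * \<alpha>) * ((1 - \<mu> / K) * gap x + \<mu> / 2 * (norm (x - z))\<^sup>2 + U / (2 * K))
        + c * \<alpha>\<^sup>2 * ((1 + s) * U - s * (2 * \<mu> * gap x) + (1 + 1 / s) * (2 * K * table_error \<phi>))"
    by (rule avg_potential_step[OF s less_imp_le[OF c] less_imp_le[OF a]])
  let ?V = "table_error \<phi>"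
  have U0: "c * \<alpha>\<^sup>2 * ((1 + s) * U) = 2 * (c * \<alpha>) * (U / (2 * K))"
  proof -
    have "c * \<alpha>\<^sup>2 * ((1 + s) * U) = c * \<alpha> * ((1 + s) * \<alpha>) * U" by (simp add: power2_eq_square)
    then show ?thesis unfolding ineq(1) by simp
  qed
  have g0: "gap x / m = 2 * (c * \<alpha>) * ((1 - \<mu> / K) * gap x) + c * \<alpha>\<^sup>2 * (s * (2 * \<mu> * gap x))"
  proof -
    have "\<alpha> * s = 1 / K - \<alpha>" using ineq(1) by (simp add: algebra_simps)
    then have eq: "1 - \<mu> / K + (\<alpha> * s) * \<mu> = 1 - \<alpha> * \<mu>" by (simp only: left_diff_distrib) simp
    have "2 * (c * \<alpha>) * (1 - \<mu> / K + (\<alpha> * s) * \<mu>) * gap x = gap x / m"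
      unfolding eq ca by simp
    then show ?thesis by (simp add: algebra_simps power2_eq_square)
  qed
  have V0: "c * \<alpha>\<^sup>2 * ((1 + 1 / s) * (2 * K * ?V)) \<le> ?V / m - \<alpha> * \<mu> * ?V"
  proof -
    have "c * \<alpha>\<^sup>2 * ((1 + 1 / s) * (2 * K * ?V)) = 2 * (c * \<alpha>) * (K * \<alpha> * (1 + 1 / s)) * ?V"
      by (simp add: power2_eq_square)
    also have "\<dots> \<le> 2 * (c * \<alpha>) * ((1 - \<alpha> * \<mu>) * (1 - \<alpha> * m * \<mu>)) * ?V"
      using c a table_error_nonneg ineq(3) by (intro mult_right_mono mult_left_mono) auto
    also have "\<dots> = 2 * (c * \<alpha>) * (1 - \<alpha> * \<mu>) * (1 - \<alpha> * m * \<mu>) * ?V" by (simp only: mult.assoc)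
    also have "\<dots> = ?V / m - \<alpha> * \<mu> * ?V" unfolding ca using m_pos by (simp add: field_simps)
    finally show ?thesis .
  qed
  have "avg (\<lambda>j. potential c (saga_step g m \<alpha> (x, \<phi>) j))
      \<le> ?V + c * (norm (x - z))\<^sup>2 - \<alpha> * \<mu> * ?V - c * \<alpha> * \<mu> * (norm (x - z))\<^sup>2"
    using step U0 g0 V0 by (simp add: distrib_left right_diff_distrib)
  then show "avg (\<lambda>j. potential c (saga_step g m \<alpha> st j)) \<le> (1 - \<alpha> * \<mu>) * potential c st"
    by (simp add: st potential_def algebra_simps)
qed

text \<open>With \<open>\<alpha> = 1 / (3 * K)\<close> and \<open>s = 2\<close> the term in \<open>U\<close> cancels; then \<open>c * \<alpha> = 1 / m\<close> makes the
  table error cancel and leaves \<open>- 1 / m\<close> as the coefficient of the gap.\<close>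

lemma potential_decrease:
  fixes \<alpha> c :: real
  defines "\<alpha> \<equiv> 1 / (3 * K)" and "c \<equiv> 3 * K / m"
  assumes "\<mu> = 0"
  shows "avg (\<lambda>j. potential c (saga_step g m \<alpha> st j)) \<le> potential c st - gap (fst st) / m"
    and "0 < c"
proof -
  obtain x \<phi> where st: "st = (x, \<phi>)" by (cases st)
  have a: "0 < \<alpha>" using K_pos by (simp add: \<alpha>_def)
  show c: "0 < c" using K_pos m_pos by (simp add: c_def)
  have ca: "c * \<alpha> = 1 / m" using K_pos by (simp add: c_def \<alpha>_def)
  have s: "(0::real) < 2" by simp
  obtain U where U: "0 \<le> U"
    and step: "avg (\<lambda>j. potential c (saga_step g m \<alpha> (x, \<phi>) j))
      \<le> table_error \<phi> + c * (norm (x - z))\<^sup>2 + gap x / m - table_error \<phi> / m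
        - 2 * (c * \<alpha>) * ((1 - \<mu> / K) * gap x + \<mu> / 2 * (norm (x - z))\<^sup>2 + U / (2 * K))
        + c * \<alpha>\<^sup>2 * ((1 + 2) * U - 2 * (2 * \<mu> * gap x) + (1 + 1 / 2) * (2 * K * table_error \<phi>))"
    by (rule avg_potential_step[OF s less_imp_le[OF c] less_imp_le[OF a]])
  have "c * \<alpha>\<^sup>2 = c * \<alpha> * \<alpha>" by (simp add: power2_eq_square)
  then have ca2: "c * \<alpha>\<^sup>2 = 1 / m * (1 / (3 * K))" unfolding ca by (simp add: \<alpha>_def)
  then have e: "c * \<alpha>\<^sup>2 * ((1 + 2) * U - 2 * (2 * \<mu> * gap x) + (1 + 1 / 2) * (2 * K * table_error \<phi>))
    = 1 / m * (U / K) + table_error \<phi> / m"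
    unfolding ca2 using K_pos m_pos \<open>\<mu> = 0\<close> by (simp add: field_simps)
  have "2 * (c * \<alpha>) * ((1 - \<mu> / K) * gap x + \<mu> / 2 * (norm (x - z))\<^sup>2 + U / (2 * K))
    = 2 * (gap x / m) + 1 / m * (U / K)"
    unfolding ca using m_pos K_pos \<open>\<mu> = 0\<close> by (simp add: field_simps)
  with step e show "avg (\<lambda>j. potential c (saga_step g m \<alpha> st j)) \<le> potential c st - gap (fst st) / m"
    by (simp add: st potential_def)
qed

lemma convex_on_gap: "convex_on UNIV gap"
proof (rule convex_onI)
  fix t :: real and x y assume t: "0 < t" "t < 1"
  have "avg (\<lambda>i. g i ((1 - t) *\<^sub>R x + t *\<^sub>R y)) \<le> avg (\<lambda>i. (1 - t) * g i x + t * g i y)"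
    using t by (intro avg_mono convex_onD[OF strongly_convex_imp_convex_on[OF strong mu_nonneg]]) auto
  then show "gap ((1 - t) *\<^sub>R x + t *\<^sub>R y) \<le> (1 - t) * gap x + t * gap y"
    unfolding gap_def by (simp only: avg_add avg_mult) (simp add: algebra_simps)
qed simp

end

locale saga = iid_indices M m J + finite_sum g m \<mu> K z
  for M :: "'w measure" and m :: nat and J :: "nat \<Rightarrow> 'w \<Rightarrow> nat"
    and g :: "nat \<Rightarrow> 'a::euclidean_space \<Rightarrow> real" and \<mu> K :: real and z :: 'a +
  fixes \<alpha> :: real and x0 :: 'a
begin

abbreviation state :: "nat \<Rightarrow> 'w \<Rightarrow> 'a \<times> (nat \<Rightarrow> 'a)" where
  "state t \<omega> \<equiv> saga_state g m \<alpha> x0 (path \<omega>) t"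

abbreviation iterate :: "nat \<Rightarrow> 'w \<Rightarrow> 'a" where
  "iterate t \<omega> \<equiv> saga_iterate g m \<alpha> x0 (path \<omega>) t"

lemma integrable_state: "integrable M (\<lambda>\<omega>. h (state t \<omega>) :: real)"
  by (rule integrable_history[OF depends_on_first_compose[OF depends_on_first_saga_state]])

lemma integrable_iterate: "integrable M (\<lambda>\<omega>. h (iterate t \<omega>) :: real)"
  by (rule integrable_history[OF depends_on_first_compose[OF depends_on_first_saga_iterate[OF order.refl]]])

lemma depends_on_first_saga_average: "depends_on_first t (\<lambda>js. saga_average g m \<alpha> x0 js t)"
  unfolding depends_on_first_def saga_average_def
proof (intro allI impI arg_cong[where f = "scaleR _"] sum.cong refl)
  fix js js' :: "nat \<Rightarrow> nat" and k assume "\<forall>s<t. js s = js' s" "k \<in> {1..t}"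
  then show "saga_iterate g m \<alpha> x0 js k = saga_iterate g m \<alpha> x0 js' k"
    using depends_on_first_saga_iterate[of k t g m \<alpha> x0] unfolding depends_on_first_def by auto
qed

lemma integrable_average: "integrable M (\<lambda>\<omega>. h (saga_average g m \<alpha> x0 (path \<omega>) t) :: real)"
  by (rule integrable_history[OF depends_on_first_compose[OF depends_on_first_saga_average]])

lemma expectation_next_state:
  fixes h :: "'a \<times> (nat \<Rightarrow> 'a) \<Rightarrow> real"
  shows "expectation (\<lambda>\<omega>. h (state (Suc t) \<omega>)) = expectation (\<lambda>\<omega>. avg (\<lambda>j. h (saga_step g m \<alpha> (state t \<omega>) j)))"
proof -
  have "expectation (\<lambda>\<omega>. h (saga_step g m \<alpha> (state t \<omega>) (J t \<omega>)))
      = expectation (\<lambda>\<omega>. (\<Sum>j=1..m. h (saga_step g m \<alpha> (state t \<omega>) j)) / m)"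
    by (rule expectation_average_next_index
        [where k = "\<lambda>j js. h (saga_step g m \<alpha> (saga_state g m \<alpha> x0 js t) j)"])
      (rule depends_on_first_compose[OF depends_on_first_saga_state])
  then show ?thesis by (simp add: saga_state_Suc_step avg_def del: saga_state.simps)
qed

theorem linear_convergence:
  assumes \<alpha>: "\<alpha> = 1 / (2 * (\<mu> * m + K))"
  shows "\<exists>C\<ge>0. \<forall>t. expectation (\<lambda>\<omega>. (norm (iterate t \<omega> - z))\<^sup>2) \<le> C * (1 - \<alpha> * \<mu>) ^ t"
proof -
  define c where "c = 1 / (2 * \<alpha> * (1 - \<alpha> * \<mu>) * m)"
  note contr = potential_contraction[folded \<alpha>, folded c_def]
  define T where "T t = expectation (\<lambda>\<omega>. potential c (state t \<omega>))" for t
  have T: "T t \<le> T 0 * (1 - \<alpha> * \<mu>) ^ t" for t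
  proof (induction t)
    case (Suc t)
    have "T (Suc t) = expectation (\<lambda>\<omega>. avg (\<lambda>j. potential c (saga_step g m \<alpha> (state t \<omega>) j)))"
      unfolding T_def by (rule expectation_next_state)
    also have "\<dots> \<le> expectation (\<lambda>\<omega>. (1 - \<alpha> * \<mu>) * potential c (state t \<omega>))"
      by (intro integral_mono integrable_state contr(1))
    also have "\<dots> = (1 - \<alpha> * \<mu>) * T t" by (simp add: T_def)
    also have "\<dots> \<le> (1 - \<alpha> * \<mu>) * (T 0 * (1 - \<alpha> * \<mu>) ^ t)"
      using Suc contr(3) by (intro mult_left_mono) auto
    finally show ?case by (simp add: mult.left_commute)
  qed simp
  have "expectation (\<lambda>\<omega>. (norm (iterate t \<omega> - z))\<^sup>2) \<le> T 0 / c * (1 - \<alpha> * \<mu>) ^ t" for t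
  proof -
    have "c * expectation (\<lambda>\<omega>. (norm (iterate t \<omega> - z))\<^sup>2)
        = expectation (\<lambda>\<omega>. c * (norm (fst (state t \<omega>) - z))\<^sup>2)"
      by (simp add: saga_iterate_def)
    also have "\<dots> \<le> T t"
      unfolding T_def
      by (intro integral_mono integrable_state) (simp add: potential_def table_error_nonneg)
    also have "\<dots> \<le> T 0 * (1 - \<alpha> * \<mu>) ^ t" by (rule T)
    finally show ?thesis using contr(2) by (simp add: pos_le_divide_eq mult.commute)
  qed
  moreover have "0 \<le> T 0 / c"
    unfolding T_def using contr(2)
    by (intro divide_nonneg_pos Bochner_Integration.integral_nonneg potential_nonneg less_imp_le)
  ultimately show ?thesis by blast
qed

text \<open>Summing the decreases of the potential bounds the sum of the expected gaps along the iterates by a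
  constant; Jensen's inequality passes this on to the average.\<close>

theorem sublinear_convergence:
  assumes \<alpha>: "\<alpha> = 1 / (3 * K)" and \<mu>: "\<mu> = 0"
  shows "\<exists>C\<ge>0. \<forall>t\<ge>1. expectation (\<lambda>\<omega>. gap (saga_average g m \<alpha> x0 (path \<omega>) t)) \<le> C / t"
proof -
  define c where "c = 3 * K / m"
  note decr = potential_decrease[OF \<mu>, folded \<alpha>, folded c_def]
  define T where "T t = expectation (\<lambda>\<omega>. potential c (state t \<omega>))" for t
  define D where "D t = expectation (\<lambda>\<omega>. gap (iterate t \<omega>))" for t
  have D0: "0 \<le> D t" for t unfolding D_def by (intro Bochner_Integration.integral_nonneg gap_nonneg)
  have T0: "0 \<le> T t" for t
    unfolding T_def using decr(2) by (intro Bochner_Integration.integral_nonneg potential_nonneg) auto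
  have step: "T (Suc t) \<le> T t - D t / m" for t
  proof -
    have "T (Suc t) = expectation (\<lambda>\<omega>. avg (\<lambda>j. potential c (saga_step g m \<alpha> (state t \<omega>) j)))"
      unfolding T_def by (rule expectation_next_state)
    also have "\<dots> \<le> expectation (\<lambda>\<omega>. potential c (state t \<omega>) - gap (fst (state t \<omega>)) / m)"
      by (intro integral_mono integrable_state decr(1))
    also have "\<dots> = T t - D t / m"
      by (subst Bochner_Integration.integral_diff[OF integrable_state integrable_state])
        (simp add: T_def D_def saga_iterate_def)
    finally show ?thesis .
  qed
  have sum: "T (Suc t) + (\<Sum>k=1..t. D k) / m \<le> T 0" for t
  proof (induction t)
    case 0
    show ?case using step[of 0] D0[of 0] m_pos by (simp add: divide_nonneg_nonneg order.trans)
  next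
    case (Suc t)
    then show ?case using step[of "Suc t"] by (simp add: add_divide_distrib)
  qed
  have "expectation (\<lambda>\<omega>. gap (saga_average g m \<alpha> x0 (path \<omega>) t)) \<le> (m * T 0) / t" if t: "1 \<le> t" for t
  proof -
    have "gap (saga_average g m \<alpha> x0 (path \<omega>) t) \<le> (\<Sum>k=1..t. 1 / t * gap (iterate k \<omega>))" for \<omega>
      unfolding saga_average_def scaleR_sum_right
      using t by (intro convex_on_sum[OF _ _ convex_on_gap]) auto
    then have "expectation (\<lambda>\<omega>. gap (saga_average g m \<alpha> x0 (path \<omega>) t))
        \<le> expectation (\<lambda>\<omega>. \<Sum>k=1..t. 1 / t * gap (iterate k \<omega>))"
      by (intro integral_mono integrable_average Bochner_Integration.integrable_sum integrable_iterate)
    also have "\<dots> = (\<Sum>k=1..t. 1 / t * D k)"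
      unfolding D_def
      by (subst Bochner_Integration.integral_sum[OF integrable_iterate]) simp
    also have "\<dots> = (\<Sum>k=1..t. D k) / t" by (simp add: sum_divide_distrib)
    also have "\<dots> \<le> (m * T 0) / t"
    proof (rule divide_right_mono)
      have "(\<Sum>k=1..t. D k) / m \<le> T 0" using sum[of t] T0[of "Suc t"] by linarith
      then show "(\<Sum>k=1..t. D k) \<le> m * T 0" using m_pos by (simp add: pos_divide_le_eq mult.commute)
    qed simp
    finally show ?thesis .
  qed
  moreover have "0 \<le> m * T 0" using T0 by simp
  ultimately show ?thesis by blast
qed

end

section \<open>The Huber penalty and exactness\<close>

text \<open>As a difference of two squared positive parts, the Huber function needs no matching of pieces:
  its derivative and the monotonicity and Lipschitz constant of the derivative can be read off.\<close>

definition huber :: "real \<Rightarrow> real \<Rightarrow> real" where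
  "huber \<delta> s = ((max 0 (s + \<delta>))\<^sup>2 - (max 0 (s - \<delta>))\<^sup>2) / (4 * \<delta>)"

definition huber_slope :: "real \<Rightarrow> real \<Rightarrow> real" where
  "huber_slope \<delta> s = (max 0 (s + \<delta>) - max 0 (s - \<delta>)) / (2 * \<delta>)"

lemma huber_penalty_eq:
  assumes "0 < \<delta>"
  shows "huber_penalty \<delta> a b x = huber \<delta> (a \<bullet> x - b) / norm a"
proof -
  define s where "s = a \<bullet> x - b"
  have "huber \<delta> s = s" if "\<delta> < s"
    using that assms by (simp add: huber_def max_def power2_eq_square field_simps)
  moreover have "huber \<delta> s = (s + \<delta>)\<^sup>2 / (4 * \<delta>)" if "- \<delta> \<le> s" "s \<le> \<delta>"
    using that assms by (simp add: huber_def max_def)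
  moreover have "huber \<delta> s = 0" if "s < - \<delta>"
    using that assms by (simp add: huber_def max_def)
  ultimately show ?thesis
    by (auto simp: huber_penalty_def s_def[symmetric])
qed

lemma DERIV_square_positive_part:
  "DERIV (\<lambda>s. (max 0 s)\<^sup>2) s :> 2 * max 0 (s :: real)"
  unfolding DERIV_def
proof (rule Lim_transform2)
  show "((\<lambda>h. 2 * max 0 s + h - h) \<longlongrightarrow> 2 * max 0 s) (at 0)" by simp
  show "((\<lambda>h. (2 * max 0 s + h - h) - ((max 0 (s + h))\<^sup>2 - (max 0 s)\<^sup>2) / h) \<longlongrightarrow> 0) (at 0)"
  proof (rule Lim_null_comparison)
    show "\<forall>\<^sub>F h in at 0. norm ((2 * max 0 s + h - h) - ((max 0 (s + h))\<^sup>2 - (max 0 s)\<^sup>2) / h) \<le> \<bar>h\<bar>"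
      using eventually_neq_at_within[of 0 0 UNIV]
    proof eventually_elim
      fix h :: real assume h: "h \<noteq> 0"
      have "\<bar>2 * max 0 s * h - ((max 0 (s + h))\<^sup>2 - (max 0 s)\<^sup>2)\<bar> \<le> h\<^sup>2"
      proof -
        consider "0 \<le> s" "0 \<le> s + h" | "s < 0" "s + h < 0" | "0 \<le> s" "s + h < 0" | "s < 0" "0 \<le> s + h"
          by linarith
        then show ?thesis
        proof cases
          case 1
          then show ?thesis by (simp add: max_def power2_eq_square algebra_simps)
        next
          case 2
          then show ?thesis by (simp add: max_def)
        next
          case 3
          have "0 \<le> (s + h)\<^sup>2" "0 \<le> h\<^sup>2" "s * (s + h) \<le> 0" "s * h \<le> 0"
            using 3 by (auto simp: mult_nonneg_nonpos)
          with 3 show ?thesis by (auto simp: max_def power2_eq_square algebra_simps abs_le_iff)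
        next
          case 4
          then have "(s + h)\<^sup>2 \<le> h\<^sup>2" by (auto simp: abs_le_square_iff[symmetric])
          with 4 show ?thesis by (auto simp: max_def)
        qed
      qed
      moreover have "(2 * max 0 s + h - h) - ((max 0 (s + h))\<^sup>2 - (max 0 s)\<^sup>2) / h
        = (2 * max 0 s * h - ((max 0 (s + h))\<^sup>2 - (max 0 s)\<^sup>2)) / h"
        using h by (simp add: field_simps)
      ultimately show "norm ((2 * max 0 s + h - h) - ((max 0 (s + h))\<^sup>2 - (max 0 s)\<^sup>2) / h) \<le> \<bar>h\<bar>"
        using h by (simp add: pos_divide_le_eq power2_eq_square abs_mult[symmetric])
    qed
    show "((\<lambda>h. \<bar>h\<bar>) \<longlongrightarrow> (0::real)) (at 0)" by (auto intro!: tendsto_eq_intros)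
  qed
qed

lemma DERIV_huber:
  assumes "0 < \<delta>"
  shows "DERIV (huber \<delta>) s :> huber_slope \<delta> s"
proof -
  have 1: "DERIV (\<lambda>s. (max 0 (s + c))\<^sup>2) s :> 2 * max 0 (s + c)" for c
    using DERIV_square_positive_part[of "s + c"] by (simp only: DERIV_shift)
  have "DERIV (\<lambda>s. ((max 0 (s + \<delta>))\<^sup>2 - (max 0 (s + - \<delta>))\<^sup>2) / (4 * \<delta>)) s :>
      (2 * max 0 (s + \<delta>) - 2 * max 0 (s + - \<delta>)) / (4 * \<delta>)"
    by (intro DERIV_cdivide DERIV_diff 1)
  moreover have "(2 * A - 2 * B) / (4 * \<delta>) = (A - B) / (2 * \<delta>)" for A B
    using assms by (simp add: field_simps)
  ultimately show ?thesis
    unfolding huber_def[abs_def] huber_slope_def by simp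
qed

lemma huber_slope_mono:
  assumes "0 < \<delta>" "r \<le> s"
  shows "huber_slope \<delta> r \<le> huber_slope \<delta> s"
  using assms by (simp add: huber_slope_def divide_right_mono max_def)

lemma huber_slope_lipschitz:
  assumes "0 < \<delta>"
  shows "\<bar>huber_slope \<delta> r - huber_slope \<delta> s\<bar> \<le> \<bar>r - s\<bar> / (2 * \<delta>)"
proof -
  have "\<bar>(max 0 (r + \<delta>) - max 0 (r - \<delta>)) - (max 0 (s + \<delta>) - max 0 (s - \<delta>))\<bar> \<le> \<bar>r - s\<bar>"
    using assms by (auto simp: max_def)
  then show ?thesis
    using assms by (simp add: huber_slope_def diff_divide_distrib[symmetric] abs_divide divide_right_mono)
qed

lemma convex_on_huber: "0 < \<delta> \<Longrightarrow> convex_on UNIV (huber \<delta>)"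
  by (rule convex_on_realI[where f' = "huber_slope \<delta>"]) (auto intro: DERIV_huber huber_slope_mono)

text \<open>The penalty compared with the exact penalty \<open>max 0 s\<close>. The value at the boundary, \<open>\<delta> / 4\<close>,
  separates feasible from infeasible points, and deep in the feasible side the penalty is zero.\<close>

lemma huber_bounds:
  assumes "0 < \<delta>"
  shows huber_ge: "max 0 s \<le> huber \<delta> s"
    and huber_feasible_le: "s \<le> 0 \<Longrightarrow> huber \<delta> s \<le> \<delta> / 4"
    and huber_infeasible_gt: "0 < s \<Longrightarrow> \<delta> / 4 < huber \<delta> s"
    and huber_interior: "s \<le> - \<delta> \<Longrightarrow> huber \<delta> s = 0"
proof -
  have up: "huber \<delta> s = s" if "\<delta> < s"
    using that assms by (simp add: huber_def max_def power2_eq_square field_simps)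
  have mid: "huber \<delta> s = (s + \<delta>)\<^sup>2 / (4 * \<delta>)" if "- \<delta> \<le> s" "s \<le> \<delta>"
    using that assms by (simp add: huber_def max_def)
  show lo: "huber \<delta> s = 0" if "s \<le> - \<delta>"
    using that assms by (simp add: huber_def max_def)
  have sq: "s * (4 * \<delta>) \<le> (s + \<delta>)\<^sup>2"
    using zero_le_power2[of "s - \<delta>"] by (simp add: power2_eq_square algebra_simps)
  show "max 0 s \<le> huber \<delta> s"
  proof (cases "- \<delta> \<le> s \<and> s \<le> \<delta>")
    case True
    then show ?thesis using mid assms sq by (simp add: pos_le_divide_eq)
  next
    case False
    then show ?thesis using up lo assms by force
  qed
  show "huber \<delta> s \<le> \<delta> / 4" if "s \<le> 0"
  proof (cases "- \<delta> \<le> s")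
    case True
    then have "(s + \<delta>)\<^sup>2 \<le> \<delta>\<^sup>2" using that assms by (intro power_mono) auto
    then show ?thesis using mid True that assms by (simp add: pos_divide_le_eq power2_eq_square)
  next
    case False
    then show ?thesis using lo assms by simp
  qed
  show "\<delta> / 4 < huber \<delta> s" if "0 < s"
  proof (cases "s \<le> \<delta>")
    case True
    have "\<delta>\<^sup>2 < (s + \<delta>)\<^sup>2" using that assms by (intro power_strict_mono) auto
    then show ?thesis using mid True that assms by (simp add: pos_less_divide_eq power2_eq_square)
  next
    case False
    then show ?thesis using up assms by simp
  qed
qed

lemma norm_min_max:
  assumes "i \<in> {1..m}"
  shows norm_min_le: "norm_min m a \<le> norm (a i)" and norm_le_max: "norm (a i) \<le> norm_max m a"
  using assms by (auto simp: norm_min_def norm_max_def)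

lemma norm_min_pos:
  assumes "0 < m" "\<And>j. j \<in> {1..m} \<Longrightarrow> a j \<noteq> 0"
  shows "0 < norm_min m a"
proof -
  have "norm_min m a \<in> (\<lambda>j. norm (a j)) ` {1..m}"
    unfolding norm_min_def using assms(1) by (intro Min_in) auto
  then show ?thesis using assms(2) by auto
qed

lemma norm_max_pos:
  assumes "0 < m" "\<And>j. j \<in> {1..m} \<Longrightarrow> a j \<noteq> 0"
  shows "0 < norm_max m a"
proof -
  have "0 < norm_min m a" using assms by (rule norm_min_pos)
  then show ?thesis using norm_min_le[of 1 m a] norm_le_max[of 1 m a] assms(1) by simp
qed

lemma strongly_convex_penalized_component:
  assumes f: "strongly_convex \<mu> f" and \<gamma>: "0 \<le> \<gamma>" and \<delta>: "0 < \<delta>"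
  shows "strongly_convex \<mu> (penalized_component f a b \<gamma> \<delta> i)"
  unfolding strongly_convex_def
proof (intro allI ballI)
  fix x y :: 'a and u :: real assume u: "u \<in> {0..1}"
  let ?h = "huber_penalty \<delta> (a i) (b i)" and ?s = "\<lambda>x. a i \<bullet> x - b i"
  have "?s (u *\<^sub>R x + (1 - u) *\<^sub>R y) = (1 - u) *\<^sub>R ?s y + u *\<^sub>R ?s x"
    by (simp add: inner_add_right algebra_simps)
  then have "huber \<delta> (?s (u *\<^sub>R x + (1 - u) *\<^sub>R y)) \<le> (1 - u) * huber \<delta> (?s y) + u * huber \<delta> (?s x)"
    using convex_onD[OF convex_on_huber[OF \<delta>], of u "?s y" "?s x"] u by simp
  then have "?h (u *\<^sub>R x + (1 - u) *\<^sub>R y) \<le> ((1 - u) * huber \<delta> (?s y) + u * huber \<delta> (?s x)) / norm (a i)"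
    unfolding huber_penalty_eq[OF \<delta>] by (intro divide_right_mono) auto
  also have "\<dots> = u * ?h x + (1 - u) * ?h y"
    unfolding huber_penalty_eq[OF \<delta>] by (simp add: add_divide_distrib add.commute)
  finally have "\<gamma> * ?h (u *\<^sub>R x + (1 - u) *\<^sub>R y) \<le> \<gamma> * (u * ?h x + (1 - u) * ?h y)"
    using \<gamma> by (rule mult_left_mono)
  moreover have "f (u *\<^sub>R x + (1 - u) *\<^sub>R y)
        \<le> u * f x + (1 - u) * f y - \<mu> / 2 * u * (1 - u) * (norm (x - y))\<^sup>2"
    using f u unfolding strongly_convex_def by blast
  ultimately show "penalized_component f a b \<gamma> \<delta> i (u *\<^sub>R x + (1 - u) *\<^sub>R y)
      \<le> u * penalized_component f a b \<gamma> \<delta> i x + (1 - u) * penalized_component f a b \<gamma> \<delta> i y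
         - \<mu> / 2 * u * (1 - u) * (norm (x - y))\<^sup>2"
    unfolding penalized_component_def by (simp add: algebra_simps)
qed

lemma GDERIV_huber_penalty:
  assumes \<delta>: "0 < \<delta>"
  shows "GDERIV (huber_penalty \<delta> a b) x :> (huber_slope \<delta> (a \<bullet> x - b) / norm a) *\<^sub>R a"
proof -
  have "GDERIV (\<lambda>x. a \<bullet> x - b) x :> a"
    unfolding gderiv_def by (auto intro!: derivative_eq_intros simp: inner_commute)
  moreover have "DERIV (\<lambda>s. huber \<delta> s / norm a) (a \<bullet> x - b) :> huber_slope \<delta> (a \<bullet> x - b) / norm a"
    by (intro DERIV_cdivide DERIV_huber \<delta>)
  ultimately have "GDERIV (\<lambda>x. huber \<delta> (a \<bullet> x - b) / norm a) x :> (huber_slope \<delta> (a \<bullet> x - b) / norm a) *\<^sub>R a"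
    by (rule GDERIV_DERIV_compose)
  then show ?thesis by (simp add: huber_penalty_eq[OF \<delta>, abs_def])
qed

lemma has_lipschitz_gradient_penalized_component:
  assumes f: "has_lipschitz_gradient K f" and \<gamma>: "0 \<le> \<gamma>" and \<delta>: "0 < \<delta>" and i: "i \<in> {1..m}"
  shows "has_lipschitz_gradient (K + \<gamma> * norm_max m a / (2 * \<delta>)) (penalized_component f a b \<gamma> \<delta> i)"
proof (rule has_lipschitz_gradientI)
  define H where "H x = (huber_slope \<delta> (a i \<bullet> x - b i) / norm (a i)) *\<^sub>R a i" for x
  fix x y
  have "GDERIV (\<lambda>x. \<gamma> * huber_penalty \<delta> (a i) (b i) x) x :> \<gamma> *\<^sub>R H x"
    using GDERIV_mult[OF GDERIV_const[of \<gamma> x] GDERIV_huber_penalty[OF \<delta>, of "a i" "b i" x]]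
    by (simp add: H_def)
  from GDERIV_add[OF has_lipschitz_gradient_GDERIV[OF f] this]
  show "GDERIV (penalized_component f a b \<gamma> \<delta> i) x :> gradient f x + \<gamma> *\<^sub>R H x"
    by (simp add: penalized_component_def[abs_def])
  have "H x - H y = ((huber_slope \<delta> (a i \<bullet> x - b i) - huber_slope \<delta> (a i \<bullet> y - b i)) / norm (a i)) *\<^sub>R a i"
    by (simp add: H_def scaleR_diff_left diff_divide_distrib)
  then have "norm (H x - H y) \<le> \<bar>huber_slope \<delta> (a i \<bullet> x - b i) - huber_slope \<delta> (a i \<bullet> y - b i)\<bar>"
    by simp
  also have "\<dots> \<le> \<bar>a i \<bullet> (x - y)\<bar> / (2 * \<delta>)"
    using huber_slope_lipschitz[OF \<delta>, of "a i \<bullet> x - b i" "a i \<bullet> y - b i"]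
    by (simp add: inner_diff_right)
  also have "\<dots> \<le> (norm_max m a * norm (x - y)) / (2 * \<delta>)"
    using \<delta> order.trans[OF Cauchy_Schwarz_ineq2 mult_right_mono[OF norm_le_max[OF i]]]
    by (intro divide_right_mono) auto
  finally have "\<gamma> * norm (H x - H y) \<le> \<gamma> * ((norm_max m a * norm (x - y)) / (2 * \<delta>))"
    using \<gamma> by (rule mult_left_mono)
  moreover have "norm ((gradient f x + \<gamma> *\<^sub>R H x) - (gradient f y + \<gamma> *\<^sub>R H y))
      \<le> norm (gradient f x - gradient f y) + norm (\<gamma> *\<^sub>R (H x - H y))"
    by (rule order.trans[OF _ norm_triangle_ineq]) (simp add: algebra_simps)
  moreover have "norm (gradient f x - gradient f y) \<le> K * norm (x - y)"
    by (rule has_lipschitz_gradient_norm[OF f])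
  ultimately show "norm ((gradient f x + \<gamma> *\<^sub>R H x) - (gradient f y + \<gamma> *\<^sub>R H y))
      \<le> (K + \<gamma> * norm_max m a / (2 * \<delta>)) * norm (x - y)"
    using \<gamma> by (simp add: distrib_right)
next
  have "0 \<le> norm_max m a" using norm_le_max[OF i, of a] norm_ge_zero order.trans by blast
  then show "0 \<le> K + \<gamma> * norm_max m a / (2 * \<delta>)"
    using has_lipschitz_gradient_nonneg[OF f] \<gamma> \<delta> by simp
qed

lemma halfspaces_inter_closed_convex:
  shows "closed (halfspaces_inter m a b)" "convex (halfspaces_inter m a b)"
proof -
  have *: "{x. a i \<bullet> x - b i \<le> 0} = {x. a i \<bullet> x \<le> b i}" for i by auto
  show "closed (halfspaces_inter m a b)" "convex (halfspaces_inter m a b)"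
    unfolding halfspaces_inter_def *
    by (auto intro!: closed_INT convex_INT closed_halfspace_le convex_halfspace_le)
qed

lemma proj_dist_le:
  assumes "closed S" "y \<in> S"
  shows "proj_dist x S \<le> norm (x - y)"
  using closest_point_le[OF assms, of x] by (simp add: proj_dist_def dist_norm)

text \<open>The bound is the distance to the foot of the perpendicular, which is a point of the half-space.\<close>

lemma proj_dist_halfspace_le:
  assumes "a \<noteq> 0"
  shows "proj_dist x {z. a \<bullet> z \<le> b} \<le> max 0 (a \<bullet> x - b) / norm a"
proof -
  define r where "r = max 0 (a \<bullet> x - b) / (norm a)\<^sup>2"
  have r: "0 \<le> r" by (simp add: r_def)
  have "a \<bullet> (x - r *\<^sub>R a) = a \<bullet> x - r * (norm a)\<^sup>2"
    by (simp add: inner_diff_right power2_norm_eq_inner)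
  also have "\<dots> = a \<bullet> x - max 0 (a \<bullet> x - b)" using assms by (simp add: r_def)
  also have "\<dots> \<le> b" by simp
  finally have "proj_dist x {z. a \<bullet> z \<le> b} \<le> norm (x - (x - r *\<^sub>R a))"
    by (intro proj_dist_le closed_halfspace_le) simp
  also have "\<dots> = max 0 (a \<bullet> x - b) / norm a"
    using assms r by (simp add: r_def power2_eq_square)
  finally show ?thesis .
qed

lemma penalized_objective_le:
  assumes m: "0 < m" and a: "\<And>j. j \<in> {1..m} \<Longrightarrow> a j \<noteq> 0" and \<gamma>: "0 \<le> \<gamma>" and \<delta>: "0 < \<delta>"
    and y: "y \<in> halfspaces_inter m a b"
  shows "penalized_objective f m a b \<gamma> \<delta> y \<le> f y + \<gamma> * \<delta> / (4 * norm_min m a)"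
proof -
  have n: "0 < norm_min m a" using m a by (rule norm_min_pos)
  have "(\<Sum>i=1..m. huber_penalty \<delta> (a i) (b i) y) \<le> (\<Sum>i=1..m. \<delta> / (4 * norm_min m a))"
  proof (rule sum_mono)
    fix i assume i: "i \<in> {1..m}"
    then have "a i \<bullet> y - b i \<le> 0" using y by (auto simp: halfspaces_inter_def)
    then have "huber_penalty \<delta> (a i) (b i) y \<le> \<delta> / 4 / norm (a i)"
      unfolding huber_penalty_eq[OF \<delta>] using huber_feasible_le[OF \<delta>] by (intro divide_right_mono) auto
    also have "\<dots> \<le> \<delta> / 4 / norm_min m a"
      using n \<delta> norm_min_le[OF i] by (intro divide_left_mono) (auto intro!: mult_pos_pos a[OF i])
    finally show "huber_penalty \<delta> (a i) (b i) y \<le> \<delta> / (4 * norm_min m a)" by simp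
  qed
  then have "\<gamma> / m * (\<Sum>i=1..m. huber_penalty \<delta> (a i) (b i) y) \<le> \<gamma> / m * (m * (\<delta> / (4 * norm_min m a)))"
    using \<gamma> by (intro mult_left_mono) auto
  also have "\<dots> = \<gamma> * \<delta> / (4 * norm_min m a)" using m by simp
  finally show ?thesis by (simp add: penalized_objective_def)
qed

lemma huber_penalty_nonneg: "0 < \<delta> \<Longrightarrow> 0 \<le> huber_penalty \<delta> a b x"
  using huber_ge[of \<delta> "a \<bullet> x - b"] by (simp add: huber_penalty_eq)

lemma penalized_objective_ge:
  assumes "0 \<le> \<gamma>" "0 < \<delta>"
  shows "f x \<le> penalized_objective f m a b \<gamma> \<delta> x"
  using assms by (simp add: penalized_objective_def sum_nonneg huber_penalty_nonneg)

text \<open>The only place where the penalty is bounded below by the distance to the whole polyhedron: each penalty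
  dominates the distance to its half-space, and Hoffman's inequality adds these up.\<close>

lemma penalized_objective_ge_dist:
  assumes m: "0 < m" and a: "\<And>j. j \<in> {1..m} \<Longrightarrow> a j \<noteq> 0" and \<gamma>: "0 \<le> \<gamma>" and \<delta>: "0 < \<delta>"
    and X: "halfspaces_inter m a b \<noteq> {}" and \<beta>: "is_hoffman_constant m a \<beta>"
  shows "f x + \<gamma> / (m * \<beta>) * proj_dist x (halfspaces_inter m a b) \<le> penalized_objective f m a b \<gamma> \<delta> x"
proof -
  have b0: "0 < \<beta>" using \<beta> by (simp add: is_hoffman_constant_def)
  have "(\<Sum>i=1..m. proj_dist x {z. a i \<bullet> z \<le> b i}) \<le> (\<Sum>i=1..m. huber_penalty \<delta> (a i) (b i) x)"
  proof (rule sum_mono)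
    fix i assume "i \<in> {1..m}"
    from proj_dist_halfspace_le[OF a[OF this], of x "b i"]
    have "proj_dist x {z. a i \<bullet> z \<le> b i} \<le> max 0 (a i \<bullet> x - b i) / norm (a i)" .
    also have "\<dots> \<le> huber_penalty \<delta> (a i) (b i) x"
      unfolding huber_penalty_eq[OF \<delta>] by (intro divide_right_mono huber_ge \<delta>) simp
    finally show "proj_dist x {z. a i \<bullet> z \<le> b i} \<le> huber_penalty \<delta> (a i) (b i) x" .
  qed
  then have "\<beta> * (\<Sum>i=1..m. proj_dist x {z. a i \<bullet> z \<le> b i}) \<le> \<beta> * (\<Sum>i=1..m. huber_penalty \<delta> (a i) (b i) x)"
    using b0 by simp
  moreover have "proj_dist x (halfspaces_inter m a b) \<le> \<beta> * (\<Sum>i=1..m. proj_dist x {z. a i \<bullet> z \<le> b i})"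
    using \<beta> X by (auto simp: is_hoffman_constant_def)
  ultimately have "proj_dist x (halfspaces_inter m a b) \<le> \<beta> * (\<Sum>i=1..m. huber_penalty \<delta> (a i) (b i) x)"
    by linarith
  then have "\<gamma> / (m * \<beta>) * proj_dist x (halfspaces_inter m a b)
      \<le> \<gamma> / (m * \<beta>) * (\<beta> * (\<Sum>i=1..m. huber_penalty \<delta> (a i) (b i) x))"
    using \<gamma> b0 by (intro mult_left_mono) auto
  then show ?thesis using b0 by (simp add: penalized_objective_def)
qed

text \<open>Hoffman's inequality for the right-hand sides \<open>b j - \<delta>\<close>; its constant serves all right-hand
  sides, which is why tightening the constraints costs only a multiple of \<open>\<delta>\<close>.\<close>

lemma proj_dist_tightened_le:
  assumes m: "0 < m" and a: "\<And>j. j \<in> {1..m} \<Longrightarrow> a j \<noteq> 0" and \<delta>: "0 < \<delta>"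
    and \<beta>: "is_hoffman_constant m a \<beta>"
    and ne: "halfspaces_inter m a (\<lambda>j. b j - \<delta>) \<noteq> {}"
    and p: "p \<in> halfspaces_inter m a b"
  shows "proj_dist p (halfspaces_inter m a (\<lambda>j. b j - \<delta>)) \<le> \<beta> * m * \<delta> / norm_min m a"
proof -
  have n: "0 < norm_min m a" using m a by (rule norm_min_pos)
  have "proj_dist p (halfspaces_inter m a (\<lambda>j. b j - \<delta>)) \<le> \<beta> * (\<Sum>i=1..m. proj_dist p {z. a i \<bullet> z \<le> b i - \<delta>})"
    using \<beta> ne unfolding is_hoffman_constant_def by blast
  also have "\<dots> \<le> \<beta> * (\<Sum>i=1..m. \<delta> / norm_min m a)"
  proof (intro mult_left_mono sum_mono)
    fix i assume i: "i \<in> {1..m}"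
    have "a i \<bullet> p - (b i - \<delta>) \<le> \<delta>" using p i by (auto simp: halfspaces_inter_def)
    then have "max 0 (a i \<bullet> p - (b i - \<delta>)) / norm (a i) \<le> \<delta> / norm (a i)"
      using \<delta> by (intro divide_right_mono) auto
    also have "\<dots> \<le> \<delta> / norm_min m a"
      using \<delta> n norm_min_le[OF i] a[OF i] by (intro divide_left_mono mult_pos_pos) auto
    finally show "proj_dist p {z. a i \<bullet> z \<le> b i - \<delta>} \<le> \<delta> / norm_min m a"
      using proj_dist_halfspace_le[OF a[OF i]] order.trans by blast
  qed (use \<beta> in \<open>simp add: is_hoffman_constant_def\<close>)
  finally show ?thesis by simp
qed

text \<open>An infeasible minimizer \<open>x\<close> at distance \<open>d\<close> from the feasible set is compared with another point.
  If \<open>d > sqrt \<delta>\<close>, this is the projection \<open>p\<close> of \<open>x\<close>: the penalty of \<open>p\<close>, at most of order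
  \<open>\<delta> < sqrt \<delta> * d\<close>, is small against that of \<open>x\<close>. If \<open>d \<le> sqrt \<delta>\<close>, it is the projection \<open>y\<close>
  onto the half-spaces tightened by \<open>\<delta>\<close>: it has no penalty at all, and lies within
  \<open>sqrt \<delta> + O(\<delta>)\<close> of \<open>x\<close>. The Slater point makes the tightened polyhedron nonempty, and the radius
  \<open>R\<close> is such that \<open>L\<close> bounds the subgradients at both \<open>p\<close> and \<open>y\<close>.\<close>

lemma penalized_minimizer_feasible:
  assumes m: "0 < m" and a: "\<And>j. j \<in> {1..m} \<Longrightarrow> a j \<noteq> 0"
    and \<beta>: "is_hoffman_constant m a \<beta>"
    and slater: "\<And>j. j \<in> {1..m} \<Longrightarrow> a j \<bullet> xbar - b j \<le> - \<epsilon>"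
    and \<gamma>: "0 < \<gamma>" and \<delta>: "0 < \<delta>" "\<delta> < min \<epsilon> (16 * (norm_min m a)\<^sup>2 / (\<beta>\<^sup>2 * (real m)\<^sup>2))"
    and c: "\<gamma> * \<delta> \<le> c"
    and radius: "is_subgradient_radius f m a b \<beta> c \<epsilon> R"
    and L: "0 \<le> L" "\<And>x y. norm y \<le> R \<Longrightarrow> f y - L * norm (x - y) \<le> f x"
    and threshold: "penalty_threshold m a \<beta> L \<delta> \<le> \<gamma>"
    and x: "x \<in> penalized_minimizers f m a b \<gamma> \<delta>"
  shows "x \<in> halfspaces_inter m a b"
proof (rule ccontr)
  let ?X = "halfspaces_inter m a b" and ?X' = "halfspaces_inter m a (\<lambda>j. b j - \<delta>)"
  let ?F = "penalized_objective f m a b \<gamma> \<delta>"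
  define p where "p = closest_point ?X x"
  define y where "y = closest_point ?X' x"
  define d where "d = norm (x - p)"
  define \<kappa> where "\<kappa> = norm_min m a"
  assume infeasible: "x \<notin> ?X"
  have b0: "0 < \<beta>" using \<beta> by (simp add: is_hoffman_constant_def)
  have k0: "0 < \<kappa>" unfolding \<kappa>_def using m a by (rule norm_min_pos)
  have M0: "0 < norm_max m a" using m a by (rule norm_max_pos)
  have "xbar \<in> ?X'" using slater \<delta> by (fastforce simp: halfspaces_inter_def)
  then have ne': "?X' \<noteq> {}" by blast
  have sub: "?X' \<subseteq> ?X" using \<delta> by (fastforce simp: halfspaces_inter_def)
  then have ne: "?X \<noteq> {}" using ne' by blast
  have p: "p \<in> ?X" unfolding p_def by (rule closest_point_in_set[OF halfspaces_inter_closed_convex(1) ne])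
  have y: "y \<in> ?X'" unfolding y_def by (rule closest_point_in_set[OF halfspaces_inter_closed_convex(1) ne'])
  have d0: "0 < d" using p infeasible by (auto simp: d_def)
  have min: "?F x \<le> ?F w" for w
    using x by (auto simp: penalized_minimizers_def is_arg_min_linorder)
  have xy: "norm (x - y) \<le> d + \<beta> * m * \<delta> / \<kappa>"
  proof -
    have "norm (x - y) = proj_dist x ?X'" by (simp add: proj_dist_def y_def)
    also have "\<dots> \<le> norm (x - closest_point ?X' p)"
      by (intro proj_dist_le halfspaces_inter_closed_convex closest_point_in_set ne')
    also have "\<dots> \<le> d + proj_dist p ?X'"
      unfolding d_def proj_dist_def using norm_triangle_ineq[of "x - p" "p - closest_point ?X' p"] by simp
    also have "\<dots> \<le> d + \<beta> * m * \<delta> / \<kappa>"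
      unfolding \<kappa>_def by (intro add_left_mono proj_dist_tightened_le m a \<delta> \<beta> ne' p)
    finally show ?thesis .
  qed
  have inR: "norm p \<le> R" "norm y \<le> R"
  proof -
    have "closest_point ?X x \<in> cball 0 R \<and> (\<forall>w\<in>?X. norm (x - w) \<le> norm (x - closest_point ?X x)
          + \<beta> * real m * \<delta> / norm_min m a \<longrightarrow> w \<in> cball 0 R)"
      using radius x \<gamma> \<delta>(1) less_imp_le[OF \<delta>(2)[THEN less_le_trans, OF min.cobounded1]] c
      unfolding is_subgradient_radius_def by blast
    moreover have "y \<in> ?X" using y sub by blast
    ultimately show "norm p \<le> R" "norm y \<le> R"
      using xy unfolding p_def[symmetric] d_def[symmetric] \<kappa>_def[symmetric] by auto
  qed
  have penalty_x: "f x + \<gamma> / (m * \<beta>) * d \<le> ?F x"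
    using penalized_objective_ge_dist[OF m a less_imp_le[OF \<gamma>] \<delta>(1) ne \<beta>, of f x]
    by (simp add: proj_dist_def d_def p_def)
  show False
  proof (cases "sqrt \<delta> < d")
    case True
    have "f x + \<gamma> / (m * \<beta>) * d \<le> f p + \<gamma> * \<delta> / (4 * \<kappa>)"
      using penalty_x min[of p] penalized_objective_le[OF m a less_imp_le[OF \<gamma>] \<delta>(1) p, of f]
      unfolding \<kappa>_def by linarith
    moreover have "f p - L * d \<le> f x" using L(2)[OF inR(1), of x] by (simp add: d_def)
    ultimately have "\<gamma> / (m * \<beta>) * d \<le> L * d + \<gamma> / (4 * \<kappa>) * \<delta>" by simp
    also have "\<gamma> / (4 * \<kappa>) * \<delta> < \<gamma> / (4 * \<kappa>) * (sqrt \<delta> * d)"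
    proof (rule mult_strict_left_mono)
      have "\<delta> = sqrt \<delta> * sqrt \<delta>" using \<delta>(1) by simp
      also have "\<dots> < sqrt \<delta> * d" using True \<delta>(1) by (intro mult_strict_left_mono) auto
      finally show "\<delta> < sqrt \<delta> * d" .
    qed (use \<gamma> k0 in simp)
    finally have "d * (\<gamma> * (1 / (m * \<beta>) - sqrt \<delta> / (4 * \<kappa>))) < d * L"
      by (simp add: algebra_simps)
    then have lt: "\<gamma> * (1 / (m * \<beta>) - sqrt \<delta> / (4 * \<kappa>)) < L" using d0 by simp
    have "sqrt \<delta> < 4 * \<kappa> / (\<beta> * m)"
    proof (rule real_less_lsqrt)
      show "0 \<le> 4 * \<kappa> / (\<beta> * m)" using k0 b0 m by simp
      show "\<delta> < (4 * \<kappa> / (\<beta> * m))\<^sup>2" using \<delta>(2) by (simp add: \<kappa>_def power_divide power_mult_distrib)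
    qed
    then have pos: "0 < 1 / (m * \<beta>) - sqrt \<delta> / (4 * \<kappa>)"
      using k0 b0 m by (simp add: field_simps)
    have "L / (1 / (m * \<beta>) - sqrt \<delta> / (4 * \<kappa>)) \<le> \<gamma>"
      unfolding divide_inverse[of L] \<kappa>_def
      by (rule order.trans[OF max.cobounded1 threshold[unfolded penalty_threshold_def]])
    with lt pos show False by (simp add: pos_divide_le_eq)
  next
    case False
    obtain j where j: "j \<in> {1..m}" and jx: "0 < a j \<bullet> x - b j"
      using infeasible by (force simp: halfspaces_inter_def)
    have "\<delta> / (4 * norm_max m a) < (\<Sum>i=1..m. huber_penalty \<delta> (a i) (b i) x)"
    proof -
      have "\<delta> / (4 * norm_max m a) \<le> \<delta> / 4 / norm (a j)"
        using \<delta>(1) M0 norm_le_max[OF j, of a] a[OF j]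
        by (simp add: frac_le)
      also have "\<dots> < huber_penalty \<delta> (a j) (b j) x"
        unfolding huber_penalty_eq[OF \<delta>(1)]
        using a[OF j] by (intro divide_strict_right_mono huber_infeasible_gt \<delta>(1) jx) simp
      also have "\<dots> \<le> (\<Sum>i=1..m. huber_penalty \<delta> (a i) (b i) x)"
        using j \<delta>(1) by (intro member_le_sum huber_penalty_nonneg) auto
      finally show ?thesis .
    qed
    then have "f x + \<gamma> / m * (\<delta> / (4 * norm_max m a)) < ?F x"
      using \<gamma> m by (simp add: penalized_objective_def mult_strict_left_mono del: times_divide_eq_left times_divide_eq_right)
    also have "?F x \<le> ?F y" by (rule min)
    also have "?F y = f y"
    proof -
      have "huber_penalty \<delta> (a i) (b i) y = 0" if "i \<in> {1..m}" for i
      proof -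
        have "a i \<bullet> y - (b i - \<delta>) \<le> 0" using y that unfolding halfspaces_inter_def by blast
        then have "a i \<bullet> y - b i \<le> - \<delta>" by simp
        then show ?thesis by (simp add: huber_penalty_eq[OF \<delta>(1)] huber_interior[OF \<delta>(1)])
      qed
      then show ?thesis by (simp add: penalized_objective_def)
    qed
    also have "f y \<le> f x + L * (sqrt \<delta> + \<beta> * m * \<delta> / \<kappa>)"
    proof -
      have "L * norm (x - y) \<le> L * (sqrt \<delta> + \<beta> * m * \<delta> / \<kappa>)"
        using xy False by (intro mult_left_mono L(1)) linarith
      then show ?thesis using L(2)[OF inR(2), of x] by linarith
    qed
    also have "sqrt \<delta> + \<beta> * m * \<delta> / \<kappa> = \<delta> * (1 / sqrt \<delta> + \<beta> * m / \<kappa>)"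
      using \<delta>(1) by (simp add: distrib_left real_div_sqrt)
    finally have "\<delta> * (\<gamma> / (4 * m * norm_max m a)) < \<delta> * (L * (1 / sqrt \<delta> + \<beta> * m / \<kappa>))"
      by (simp add: mult.commute mult.left_commute)
    then have "\<gamma> / (4 * m * norm_max m a) < L * (1 / sqrt \<delta> + \<beta> * m / \<kappa>)"
      using \<delta>(1) by (simp only: mult_less_cancel_left_pos)
    then have "\<gamma> < L * (1 / sqrt \<delta> + \<beta> * m / \<kappa>) * (4 * m * norm_max m a)"
      using m M0 by (subst (asm) pos_divide_less_eq) simp_all
    also have "\<dots> = 4 * real m * L * norm_max m a * (1 / sqrt \<delta> + \<beta> * m / \<kappa>)"
      by (simp only: mult_ac of_nat_mult of_nat_numeral)
    finally have "\<gamma> < 4 * real m * L * norm_max m a * (1 / sqrt \<delta> + \<beta> * m / \<kappa>)" .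
    moreover have "4 * real m * L * norm_max m a * (1 / sqrt \<delta> + \<beta> * m / \<kappa>) \<le> \<gamma>"
      unfolding \<kappa>_def
      by (rule order.trans[OF max.cobounded2 threshold[unfolded penalty_threshold_def]])
    ultimately show False by simp
  qed
qed

text \<open>A subgradient differing from the gradient would contradict the quadratic upper bound after a
  step of length \<open>1 / K\<close> in the direction of the difference.\<close>

lemma subdiff_eq_gradient:
  assumes f: "convex_on UNIV f" "has_lipschitz_gradient K f" and K: "0 < K"
  shows "subdiff f x = {gradient f x}"
proof (intro equalityI subsetI)
  fix s assume "s \<in> subdiff f x"
  define v where "v = s - gradient f x"
  let ?y = "x + (1 / K) *\<^sub>R v"
  have "f x + s \<bullet> (?y - x) \<le> f ?y" using \<open>s \<in> subdiff f x\<close> unfolding subdiff_def by blast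
  also have "f ?y \<le> f x + gradient f x \<bullet> (?y - x) + K / 2 * (norm (?y - x))\<^sup>2"
    by (rule quadratic_upper_bound[OF f(2)])
  finally have "s \<bullet> (?y - x) - gradient f x \<bullet> (?y - x) \<le> K / 2 * (norm (?y - x))\<^sup>2" by linarith
  then have "v \<bullet> (?y - x) \<le> K / 2 * (norm (?y - x))\<^sup>2" by (simp only: v_def inner_diff_left)
  moreover have "v \<bullet> (?y - x) = 2 * ((norm v)\<^sup>2 / (2 * K))" by (simp add: power2_norm_eq_inner)
  moreover have "K / 2 * (norm (?y - x))\<^sup>2 = (norm v)\<^sup>2 / (2 * K)"
    using K by (simp add: power_divide power2_eq_square)
  ultimately have "(norm v)\<^sup>2 / (2 * K) \<le> 0" by linarith
  then show "s \<in> {gradient f x}" using K by (simp add: divide_le_0_iff v_def)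
next
  fix s assume "s \<in> {gradient f x}"
  then show "s \<in> subdiff f x"
    using convex_on_UNIV_imp_above_tangent[OF f(1) has_lipschitz_gradient_GDERIV[OF f(2)], of x]
    by (simp add: subdiff_def)
qed

text \<open>The maximum defining the bound is attained by continuity of the gradient on the compact ball; only
  then does the greatest element exist and the tangent inequality apply with this constant.\<close>

lemma subgradient_bound_smooth:
  assumes f: "convex_on UNIV f" "has_lipschitz_gradient K f" and K: "0 < K" and R: "0 < R"
  shows norm_gradient_le_subgradient_bound: "norm x \<le> R \<Longrightarrow> norm (gradient f x) \<le> subgradient_bound f R"
    and subgradient_bound_nonneg: "0 \<le> subgradient_bound f R"
    and subgradient_bound_below: "norm y \<le> R \<Longrightarrow> f y - subgradient_bound f R * norm (x - y) \<le> f x"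
proof -
  have "continuous_on UNIV (gradient f)"
    using f(2) lipschitz_on_continuous_on unfolding has_lipschitz_gradient_def by blast
  then have "continuous_on (cball 0 R) (\<lambda>x. norm (gradient f x))"
    by (intro continuous_on_norm) (rule continuous_on_subset, auto)
  then obtain w where w: "w \<in> cball 0 R" "\<And>x. x \<in> cball 0 R \<Longrightarrow> norm (gradient f x) \<le> norm (gradient f w)"
    using continuous_attains_sup[of "cball 0 R" "\<lambda>x. norm (gradient f x)"] R by (auto simp: cball_eq_empty)
  have "subgradient_bound f R = norm (gradient f w)"
    unfolding subgradient_bound_def subdiff_eq_gradient[OF f K]
    by (rule Greatest_equality) (use w in auto)
  then show *: "norm x \<le> R \<Longrightarrow> norm (gradient f x) \<le> subgradient_bound f R" for x
    using w(2) by simp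
  show "0 \<le> subgradient_bound f R" using *[of 0] R order.trans[OF norm_ge_zero] by simp
  show "f y - subgradient_bound f R * norm (x - y) \<le> f x" if "norm y \<le> R"
  proof -
    have "f y + gradient f y \<bullet> (x - y) \<le> f x"
      by (rule convex_on_UNIV_imp_above_tangent[OF f(1) has_lipschitz_gradient_GDERIV[OF f(2)]])
    moreover have "- (gradient f y \<bullet> (x - y)) \<le> norm (gradient f y) * norm (x - y)"
      using Cauchy_Schwarz_ineq2[of "gradient f y" "x - y"] by linarith
    moreover have "\<dots> \<le> subgradient_bound f R * norm (x - y)"
      by (intro mult_right_mono *[OF that]) simp
    ultimately show ?thesis by linarith
  qed
qed

section \<open>Minimizers and the convergence theorem\<close>

lemma attains_min_if_bounded_sublevel:
  fixes F :: "'a::euclidean_space \<Rightarrow> real"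
  assumes F: "continuous_on UNIV F" and bdd: "bounded {x. F x \<le> F y}" and S: "closed S" "y \<in> S"
  obtains x where "x \<in> S" "\<And>w. w \<in> S \<Longrightarrow> F x \<le> F w"
proof -
  let ?A = "S \<inter> {x. F x \<le> F y}"
  have "closed {x. F x \<le> F y}"
    by (intro closed_Collect_le F continuous_on_const)
  then have "compact ?A"
    using S(1) bdd by (meson bounded_subset closed_Int compact_eq_bounded_closed inf_le2)
  moreover have "?A \<noteq> {}" using S(2) by auto
  ultimately have "\<exists>x\<in>?A. \<forall>w\<in>?A. F x \<le> F w"
    by (intro continuous_attains_inf continuous_on_subset[OF F subset_UNIV])
  then obtain x where x: "x \<in> ?A" "\<forall>w\<in>?A. F x \<le> F w" by (rule bexE)
  have "F x \<le> F w" if "w \<in> S" for w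
    using x that by (cases "F w \<le> F y") auto
  with x(1) show ?thesis using that by blast
qed

lemma strongly_convex_bounded_level_sets:
  assumes f: "strongly_convex \<mu> f" and \<mu>: "0 < \<mu>" and K: "has_lipschitz_gradient K f"
  shows "bounded_level_sets f"
  unfolding bounded_level_sets_def
proof
  fix r
  define G A where "G = norm (gradient f 0)" and "A = \<bar>r - f 0\<bar>"
  have "norm y \<le> 1 + 2 / \<mu> * (A + G)" if "f y \<le> r" for y
  proof (rule ccontr)
    assume "\<not> norm y \<le> 1 + 2 / \<mu> * (A + G)"
    then have n: "1 + 2 / \<mu> * (A + G) < norm y" by simp
    have AG: "0 \<le> A" "0 \<le> G" by (simp_all add: A_def G_def)
    then have "0 \<le> 2 / \<mu> * (A + G)" using \<mu> by simp
    then have n1: "1 < norm y" "2 / \<mu> * (A + G) < norm y" using n by linarith+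
    have "A + G < \<mu> / 2 * norm y" using n1(2) \<mu> by (simp add: field_simps)
    then have "(A + G) * norm y < \<mu> / 2 * norm y * norm y"
      using n1(1) by (intro mult_strict_right_mono) auto
    moreover have "A * 1 \<le> A * norm y" using n1 AG by (intro mult_left_mono) auto
    moreover have "f 0 + gradient f 0 \<bullet> (y - 0) + \<mu> / 2 * (norm (y - 0))\<^sup>2 \<le> f y"
      by (rule strongly_convex_above_tangent[OF f less_imp_le[OF \<mu>] has_lipschitz_gradient_GDERIV[OF K]])
    moreover have "- (gradient f 0 \<bullet> y) \<le> G * norm y"
      unfolding G_def using Cauchy_Schwarz_ineq2[of "gradient f 0" y] by linarith
    moreover have "r - f 0 \<le> A" by (simp add: A_def)
    ultimately show False using \<open>f y \<le> r\<close> by (simp add: power2_eq_square distrib_right)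
  qed
  then show "bounded {x. f x \<le> r}" by (auto simp: bounded_iff)
qed

text \<open>Lower and upper parabola at one point, compared at another one. It yields the strict inequality between
  the two constants that the analysis of SAGA asks for, since the penalty adds to the smoothness.\<close>

lemma strong_convexity_le_smoothness:
  fixes f :: "'a::euclidean_space \<Rightarrow> real"
  assumes f: "strongly_convex \<mu> f" "0 \<le> \<mu>" and K: "has_lipschitz_gradient K f"
  shows "\<mu> \<le> K"
proof -
  obtain e :: 'a where e: "norm e = 1" using vector_choose_size[of 1] by auto
  have "f 0 + gradient f 0 \<bullet> (e - 0) + \<mu> / 2 * (norm (e - 0))\<^sup>2 \<le> f e"
    by (rule strongly_convex_above_tangent[OF f has_lipschitz_gradient_GDERIV[OF K]])
  moreover have "f e \<le> f 0 + gradient f 0 \<bullet> (e - 0) + K / 2 * (norm (e - 0))\<^sup>2"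
    by (rule quadratic_upper_bound[OF K])
  ultimately show ?thesis using e by simp
qed

lemma penalized_objective_eq_average:
  assumes "0 < m"
  shows "penalized_objective f m a b \<gamma> \<delta> x = (\<Sum>i=1..m. penalized_component f a b \<gamma> \<delta> i x) / m"
  using assms
  by (simp add: penalized_objective_def penalized_component_def sum.distrib sum_distrib_left[symmetric]
      add_divide_distrib)

text \<open>The assumptions shared by the two parts of the theorem. Bounded level sets hold in the strongly convex
  part as well (\<open>strongly_convex_bounded_level_sets\<close>), and the upper bounds on \<open>\<gamma>\<close> enter only through
  \<open>\<gamma> * \<delta> \<le> c\<close>.\<close>

locale penalized_problem =
  fixes f :: "'a::euclidean_space \<Rightarrow> real" and m :: nat and a :: "nat \<Rightarrow> 'a" and b :: "nat \<Rightarrow> real"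
    and xbar :: 'a and \<epsilon> \<beta> c R Lf \<gamma> \<delta> :: real
  assumes m: "0 < m"
    and f_convex: "convex_on UNIV f"
    and a_nonzero: "\<And>j. j \<in> {1..m} \<Longrightarrow> a j \<noteq> 0"
    and hoffman: "is_hoffman_constant m a \<beta>"
    and slater: "\<And>j. j \<in> {1..m} \<Longrightarrow> a j \<bullet> xbar - b j \<le> - \<epsilon>"
    and radius: "is_subgradient_radius f m a b \<beta> c \<epsilon> R"
    and Lf: "0 < Lf" and f_smooth: "has_lipschitz_gradient Lf f"
    and level_sets: "bounded_level_sets f"
    and \<gamma>: "0 < \<gamma>"
    and \<delta>: "0 < \<delta>" "\<delta> < min \<epsilon> (16 * (norm_min m a)\<^sup>2 / (\<beta>\<^sup>2 * (real m)\<^sup>2))"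
    and threshold: "penalty_threshold m a \<beta> (subgradient_bound f R) \<delta> \<le> \<gamma>"
    and c: "\<gamma> * \<delta> \<le> c"
begin

abbreviation X :: "'a set" where "X \<equiv> halfspaces_inter m a b"
abbreviation g :: "nat \<Rightarrow> 'a \<Rightarrow> real" where "g \<equiv> penalized_component f a b \<gamma> \<delta>"
abbreviation F :: "'a \<Rightarrow> real" where "F \<equiv> penalized_objective f m a b \<gamma> \<delta>"
abbreviation smoothness :: real where "smoothness \<equiv> Lf + \<gamma> * norm_max m a / (2 * \<delta>)"

lemma feasible: "xbar \<in> X"
  using slater \<delta> by (fastforce simp: halfspaces_inter_def)

lemma f_continuous: "continuous_on S f"
  by (rule has_lipschitz_gradient_continuous_on[OF f_smooth])

lemma F_continuous: "continuous_on S F"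
proof -
  have "continuous_on S (g i)" if "i \<in> {1..m}" for i
    using has_lipschitz_gradient_continuous_on
      has_lipschitz_gradient_penalized_component[OF f_smooth less_imp_le[OF \<gamma>] \<delta>(1) that] by blast
  then show ?thesis
    unfolding penalized_objective_eq_average[OF m, abs_def]
    using m by (intro continuous_on_divide continuous_on_sum continuous_on_const) auto
qed

lemma minimizer_feasible:
  assumes "\<And>y. F x \<le> F y"
  shows "x \<in> X"
proof (rule penalized_minimizer_feasible[OF m a_nonzero hoffman slater \<gamma> \<delta> c radius _ _ threshold])
  have R: "0 < R" using radius by (simp add: is_subgradient_radius_def)
  show "0 \<le> subgradient_bound f R"
    by (rule subgradient_bound_nonneg[OF f_convex f_smooth Lf R])
  show "f y - subgradient_bound f R * norm (x - y) \<le> f x" if "norm y \<le> R" for x y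
    by (rule subgradient_bound_below[OF f_convex f_smooth Lf R that])
  show "x \<in> penalized_minimizers f m a b \<gamma> \<delta>"
    using assms by (simp add: penalized_minimizers_def is_arg_min_linorder)
qed

lemma f_le_F: "f x \<le> F x"
  by (rule penalized_objective_ge[OF less_imp_le[OF \<gamma>] \<delta>(1)])

lemma F_le_f: "y \<in> X \<Longrightarrow> F y \<le> f y + \<gamma> * \<delta> / (4 * norm_min m a)"
  by (rule penalized_objective_le[OF m a_nonzero less_imp_le[OF \<gamma>] \<delta>(1)])

lemma exists_minimizer:
  obtains z where "z \<in> X" "\<And>y. F z \<le> F y"
proof -
  have "{x. F x \<le> F xbar} \<subseteq> {x. f x \<le> F xbar}" using f_le_F order.trans by blast
  then have "bounded {x. F x \<le> F xbar}"
    using level_sets bounded_subset unfolding bounded_level_sets_def by blast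
  then obtain z where "\<And>y. F z \<le> F y"
    using attains_min_if_bounded_sublevel[OF F_continuous _ closed_UNIV, of xbar] by auto
  with minimizer_feasible that show ?thesis by blast
qed

lemma exists_constrained_minimizer:
  obtains w where "w \<in> X" "\<And>y. y \<in> X \<Longrightarrow> f w \<le> f y"
proof -
  have "bounded {x. f x \<le> f xbar}" using level_sets by (simp add: bounded_level_sets_def)
  from attains_min_if_bounded_sublevel[OF f_continuous this halfspaces_inter_closed_convex(1) feasible]
  show ?thesis using that by metis
qed

lemma saga_penalized:
  assumes iid: "iid_uniform_indices M m J"
    and f: "strongly_convex \<mu> f" "0 \<le> \<mu>" and z: "\<And>y. F z \<le> F y"
  shows "saga M m J g \<mu> smoothness z"
proof -
  have "0 < norm_max m a" by (rule norm_max_pos[OF m a_nonzero])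
  then have "0 < \<gamma> * norm_max m a / (2 * \<delta>)" using \<gamma> \<delta>(1) by simp
  then have "\<mu> < smoothness" using strong_convexity_le_smoothness[OF f f_smooth] by linarith
  moreover have "(\<Sum>i=1..m. g i z) \<le> (\<Sum>i=1..m. g i y)" for y
    using z[of y] m by (simp add: penalized_objective_eq_average divide_le_cancel)
  ultimately have "finite_sum g m \<mu> smoothness z"
    using m f strongly_convex_penalized_component[OF f(1) less_imp_le[OF \<gamma>] \<delta>(1)]
      has_lipschitz_gradient_penalized_component[OF f_smooth less_imp_le[OF \<gamma>] \<delta>(1)]
    unfolding finite_sum_def by blast
  moreover have "iid_indices M m J"
    using iid m by (simp add: iid_indices_def iid_indices_axioms_def iid_uniform_indices_def)
  ultimately show ?thesis by (rule saga.intro[rotated])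
qed

text \<open>The minimizer \<open>z\<close> of the penalized objective is feasible and within \<open>sqrt \<delta>0\<close> of the constrained
  minimizer; the inequality \<open>(p + q)\<^sup>2 \<le> 2 * p\<^sup>2 + 2 * q\<^sup>2\<close> produces the summand \<open>2 * \<delta>0\<close>.\<close>

lemma strongly_convex_rates:
  assumes iid: "iid_uniform_indices M m J"
    and f: "strongly_convex \<mu> f" "0 < \<mu>"
    and accuracy: "\<gamma> * \<delta> \<le> 2 * \<mu> * norm_min m a * \<delta>0"
    and \<alpha>: "\<alpha> = 1 / (2 * (\<mu> * m + smoothness))"
  shows "\<exists>C. \<forall>t. (\<integral>\<omega>. (norm (saga_iterate g m \<alpha> x0 (\<lambda>s. J s \<omega>) t
            - closest_point X (saga_iterate g m \<alpha> x0 (\<lambda>s. J s \<omega>) t)))\<^sup>2 \<partial>M) \<le> C * (1 - \<alpha> * \<mu>) ^ t"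
    and "\<exists>C. \<forall>t. (\<integral>\<omega>. (norm (saga_iterate g m \<alpha> x0 (\<lambda>s. J s \<omega>) t - arg_min_on f X))\<^sup>2 \<partial>M)
            \<le> C * (1 - \<alpha> * \<mu>) ^ t + 2 * \<delta>0"
proof -
  obtain z where z: "z \<in> X" "\<And>y. F z \<le> F y" using exists_minimizer by blast
  interpret saga M m J g \<mu> smoothness z \<alpha> x0
    using f by (intro saga_penalized iid z) auto
  obtain C where C: "\<And>t. expectation (\<lambda>\<omega>. (norm (iterate t \<omega> - z))\<^sup>2) \<le> C * (1 - \<alpha> * \<mu>) ^ t"
    using linear_convergence[OF \<alpha>] by blast
  have "expectation (\<lambda>\<omega>. (norm (iterate t \<omega> - closest_point X (iterate t \<omega>)))\<^sup>2) \<le> C * (1 - \<alpha> * \<mu>) ^ t" for t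
  proof -
    have "expectation (\<lambda>\<omega>. (norm (iterate t \<omega> - closest_point X (iterate t \<omega>)))\<^sup>2)
       \<le> expectation (\<lambda>\<omega>. (norm (iterate t \<omega> - z))\<^sup>2)"
    proof (intro integral_mono power_mono norm_ge_zero)
      show "integrable M (\<lambda>\<omega>. (norm (iterate t \<omega> - closest_point X (iterate t \<omega>)))\<^sup>2)"
        by (rule integrable_iterate[of "\<lambda>x. (norm (x - closest_point X x))\<^sup>2"])
      show "integrable M (\<lambda>\<omega>. (norm (iterate t \<omega> - z))\<^sup>2)"
        by (rule integrable_iterate[of "\<lambda>x. (norm (x - z))\<^sup>2"])
      show "norm (iterate t \<omega> - closest_point X (iterate t \<omega>)) \<le> norm (iterate t \<omega> - z)" for \<omega>
        using proj_dist_le[OF halfspaces_inter_closed_convex(1) z(1)] by (simp add: proj_dist_def)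
    qed
    with C[of t] show ?thesis by linarith
  qed
  then show "\<exists>C. \<forall>t. expectation (\<lambda>\<omega>. (norm (iterate t \<omega> - closest_point X (iterate t \<omega>)))\<^sup>2) \<le> C * (1 - \<alpha> * \<mu>) ^ t"
    by blast
  define w where "w = arg_min_on f X"
  have w: "w \<in> X" "\<And>y. y \<in> X \<Longrightarrow> f w \<le> f y"
  proof -
    obtain w' where "w' \<in> X" "\<And>y. y \<in> X \<Longrightarrow> f w' \<le> f y" using exists_constrained_minimizer by blast
    then have "is_arg_min f (\<lambda>x. x \<in> X) w"
      unfolding w_def arg_min_on_def arg_min_def
      by (intro someI[of "is_arg_min f (\<lambda>x. x \<in> X)" w']) (simp add: is_arg_min_linorder)
    then show "w \<in> X" "\<And>y. y \<in> X \<Longrightarrow> f w \<le> f y" by (auto simp: is_arg_min_linorder)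
  qed
  have k0: "0 < norm_min m a" by (rule norm_min_pos[OF m a_nonzero])
  have zw: "(norm (z - w))\<^sup>2 \<le> \<delta>0"
  proof -
    have "f w + \<mu> / 2 * (norm (z - w))\<^sup>2 \<le> f z"
      by (rule strongly_convex_min_growth[OF f(1) halfspaces_inter_closed_convex(2) w(1) z(1) w(2)])
    also have "\<dots> \<le> f w + \<gamma> * \<delta> / (4 * norm_min m a)"
      using f_le_F[of z] z(2)[of w] F_le_f[OF w(1)] by linarith
    also have "\<gamma> * \<delta> / (4 * norm_min m a) \<le> 2 * \<mu> * norm_min m a * \<delta>0 / (4 * norm_min m a)"
      using k0 by (intro divide_right_mono accuracy) simp
    also have "\<dots> = \<mu> / 2 * \<delta>0" using k0 by simp
    finally have "\<mu> / 2 * (norm (z - w))\<^sup>2 \<le> \<mu> / 2 * \<delta>0" by simp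
    then show ?thesis using f(2) by (simp only: mult_le_cancel_left_pos half_gt_zero)
  qed
  have "expectation (\<lambda>\<omega>. (norm (iterate t \<omega> - w))\<^sup>2) \<le> 2 * C * (1 - \<alpha> * \<mu>) ^ t + 2 * \<delta>0" for t
  proof -
    have "expectation (\<lambda>\<omega>. (norm (iterate t \<omega> - w))\<^sup>2)
       \<le> expectation (\<lambda>\<omega>. 2 * (norm (iterate t \<omega> - z))\<^sup>2 + 2 * \<delta>0)"
    proof (rule integral_mono)
      show "integrable M (\<lambda>\<omega>. (norm (iterate t \<omega> - w))\<^sup>2)"
        by (rule integrable_iterate[of "\<lambda>x. (norm (x - w))\<^sup>2"])
      show "integrable M (\<lambda>\<omega>. 2 * (norm (iterate t \<omega> - z))\<^sup>2 + 2 * \<delta>0)"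
        by (rule integrable_iterate[of "\<lambda>x. 2 * (norm (x - z))\<^sup>2 + 2 * \<delta>0"])
      fix \<omega>
      have "(norm ((iterate t \<omega> - z) - (w - z)))\<^sup>2 \<le> (1 + 1) * (norm (iterate t \<omega> - z))\<^sup>2 + (1 + 1 / 1) * (norm (w - z))\<^sup>2"
        by (rule norm_diff_square_le) simp
      then show "(norm (iterate t \<omega> - w))\<^sup>2 \<le> 2 * (norm (iterate t \<omega> - z))\<^sup>2 + 2 * \<delta>0"
        using zw by (simp add: norm_minus_commute)
    qed
    also have "\<dots> = 2 * expectation (\<lambda>\<omega>. (norm (iterate t \<omega> - z))\<^sup>2) + 2 * \<delta>0"
      using integrable_iterate[of "\<lambda>x. (norm (x - z))\<^sup>2" t] by (simp add: prob_space)
    also have "\<dots> \<le> 2 * C * (1 - \<alpha> * \<mu>) ^ t + 2 * \<delta>0" using C[of t] by simp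
    finally show ?thesis .
  qed
  then show "\<exists>C. \<forall>t. expectation (\<lambda>\<omega>. (norm (iterate t \<omega> - arg_min_on f X))\<^sup>2) \<le> C * (1 - \<alpha> * \<mu>) ^ t + 2 * \<delta>0"
    unfolding w_def by blast
qed

text \<open>The points where \<open>f\<close> is below \<open>v - e\<close> form a compact set without minimizers of \<open>F\<close>, because minimizers
  are feasible. So the gap has a positive minimum there, and a large enough multiple of it compensates
  for the greatest possible drop of \<open>f\<close>.\<close>

lemma infeasibility_controlled_by_gap:
  assumes z: "\<And>y. F z \<le> F y" and v: "\<And>y. y \<in> X \<Longrightarrow> v \<le> f y" and e: "0 < e"
  obtains A where "0 \<le> A" "\<And>x. v - e - A * (F x - F z) \<le> f x"
proof (cases "{x. f x \<le> v - e} = {}")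
  case True
  then have "\<not> f x \<le> v - e" for x by blast
  then have "v - e - 0 * (F x - F z) \<le> f x" for x by (metis diff_zero mult_zero_left nle_le)
  then show ?thesis using that[of 0] by blast
next
  case False
  let ?S = "{x. f x \<le> v - e}"
  have "closed ?S" by (intro closed_Collect_le f_continuous continuous_on_const)
  then have S: "compact ?S"
    using level_sets by (simp add: bounded_level_sets_def compact_eq_bounded_closed)
  obtain s where s: "s \<in> ?S" "\<And>x. x \<in> ?S \<Longrightarrow> F s \<le> F x"
    using continuous_attains_inf[OF S False F_continuous] by blast
  obtain r where r: "r \<in> ?S" "\<And>x. x \<in> ?S \<Longrightarrow> f r \<le> f x"
    using continuous_attains_inf[OF S False f_continuous] by blast
  have pos: "0 < F s - F z"
  proof (rule ccontr)
    assume "\<not> 0 < F s - F z"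
    then have "F s \<le> F y" for y using z[of y] by linarith
    then have "v \<le> f s" by (intro v minimizer_feasible)
    then show False using s(1) e by simp
  qed
  define A where "A = (v - f r) / (F s - F z)"
  have A: "0 \<le> A" unfolding A_def using pos r(1) e by (intro divide_nonneg_pos) auto
  have "v - e - A * (F x - F z) \<le> f x" for x
  proof (cases "x \<in> ?S")
    case True
    have "v - f r = A * (F s - F z)" using pos by (simp add: A_def)
    also have "\<dots> \<le> A * (F x - F z)" using s(2)[OF True] A by (intro mult_left_mono) auto
    finally show ?thesis using r(2)[OF True] e by linarith
  next
    case False
    moreover have "0 \<le> A * (F x - F z)" using A z[of x] by simp
    ultimately show ?thesis by simp
  qed
  with A that show ?thesis by blast
qed

text \<open>As \<open>f \<le> F\<close>, the expected gap bounds \<open>f\<close> at the averages from above. From below, the previous lemma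
  turns the vanishing expected gap into a bound; it applies to expectations because it is affine in the gap.\<close>

lemma convex_rates:
  assumes iid: "iid_uniform_indices M m J"
    and accuracy: "\<gamma> * \<delta> \<le> 4 * norm_min m a * \<delta>0"
    and \<alpha>: "\<alpha> = 1 / (3 * smoothness)"
  defines "v \<equiv> LEAST v. v \<in> f ` X"
  shows "\<exists>C. \<forall>t\<ge>1. (\<integral>\<omega>. f (saga_average g m \<alpha> x0 (\<lambda>s. J s \<omega>) t) \<partial>M) - v \<le> C * (4 * real m / real t) + \<delta>0"
    and "\<And>e. 0 < e \<Longrightarrow> \<exists>T>0. \<forall>t>T. - e \<le> (\<integral>\<omega>. f (saga_average g m \<alpha> x0 (\<lambda>s. J s \<omega>) t) \<partial>M) - v"
proof -
  obtain z where z: "z \<in> X" "\<And>y. F z \<le> F y" using exists_minimizer by blast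
  obtain w where w: "w \<in> X" "\<And>y. y \<in> X \<Longrightarrow> f w \<le> f y" using exists_constrained_minimizer by blast
  have vw: "v = f w" unfolding v_def using w by (intro Least_equality) auto
  have "strongly_convex 0 f"
    using convex_onD[OF f_convex] unfolding strongly_convex_def by (auto simp: add.commute)
  then interpret saga M m J g 0 smoothness z \<alpha> x0
    by (intro saga_penalized iid z) auto
  let ?xav = "\<lambda>t \<omega>. saga_average g m \<alpha> x0 (path \<omega>) t"
  have gap: "gap x = F x - F z" for x
    by (simp add: gap_def avg_def penalized_objective_eq_average[OF m])
  obtain C where C: "0 \<le> C" "\<And>t. 1 \<le> t \<Longrightarrow> expectation (\<lambda>\<omega>. gap (?xav t \<omega>)) \<le> C / t"
    using sublinear_convergence[OF \<alpha>] by blast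
  have k0: "0 < norm_min m a" by (rule norm_min_pos[OF m a_nonzero])
  have Fz: "F z \<le> v + \<delta>0"
  proof -
    have "F z \<le> f w + \<gamma> * \<delta> / (4 * norm_min m a)" using z(2)[of w] F_le_f[OF w(1)] by linarith
    also have "\<gamma> * \<delta> / (4 * norm_min m a) \<le> 4 * norm_min m a * \<delta>0 / (4 * norm_min m a)"
      using k0 by (intro divide_right_mono accuracy) simp
    also have "\<dots> = \<delta>0" using k0 by simp
    finally show ?thesis by (simp add: vw)
  qed
  have "expectation (\<lambda>\<omega>. f (?xav t \<omega>)) - v \<le> C / (4 * m) * (4 * real m / real t) + \<delta>0" if t: "1 \<le> t" for t
  proof -
    have "expectation (\<lambda>\<omega>. f (?xav t \<omega>)) \<le> expectation (\<lambda>\<omega>. gap (?xav t \<omega>) + F z)"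
      by (intro integral_mono integrable_average[of f] integrable_average[of "\<lambda>x. gap x + F z"])
        (simp add: gap f_le_F)
    also have "\<dots> = expectation (\<lambda>\<omega>. gap (?xav t \<omega>)) + F z"
      using integrable_average[of gap t] by (simp add: prob_space)
    also have "\<dots> \<le> C / t + (v + \<delta>0)" using C(2)[OF t] Fz by simp
    finally show ?thesis using m by simp
  qed
  then show "\<exists>C. \<forall>t\<ge>1. expectation (\<lambda>\<omega>. f (?xav t \<omega>)) - v \<le> C * (4 * real m / real t) + \<delta>0"
    by blast
  show "\<exists>T>0. \<forall>t>T. - e \<le> expectation (\<lambda>\<omega>. f (?xav t \<omega>)) - v" if e: "0 < e" for e
  proof -
    obtain A where A: "0 \<le> A" "\<And>x. v - e / 2 - A * (F x - F z) \<le> f x"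
      using infeasibility_controlled_by_gap[of z v "e / 2"] z(2) w(2) vw e by auto
    obtain T where T: "2 * A * C / e < real T" using reals_Archimedean2 by blast
    have "- e \<le> expectation (\<lambda>\<omega>. f (?xav t \<omega>)) - v" if t: "Suc T < t" for t
    proof -
      have "v - e / 2 - A * expectation (\<lambda>\<omega>. gap (?xav t \<omega>))
          = expectation (\<lambda>\<omega>. v - e / 2 - A * gap (?xav t \<omega>))"
        using integrable_average[of gap t] by (simp add: prob_space)
      also have "\<dots> \<le> expectation (\<lambda>\<omega>. f (?xav t \<omega>))"
        using A(2) by (intro integral_mono integrable_average[of f]
            integrable_average[of "\<lambda>x. v - e / 2 - A * gap x"]) (simp add: gap)
      finally have "v - e / 2 - A * expectation (\<lambda>\<omega>. gap (?xav t \<omega>)) \<le> expectation (\<lambda>\<omega>. f (?xav t \<omega>))" .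
      moreover have "A * expectation (\<lambda>\<omega>. gap (?xav t \<omega>)) \<le> A * (C / t)"
        using A(1) C(2)[of t] t by (intro mult_left_mono) auto
      moreover have "A * (C / t) \<le> e / 2"
      proof -
        have "2 * A * C < real T * e" using T e by (simp add: pos_divide_less_eq)
        also have "\<dots> \<le> real t * e" using t e by (intro mult_right_mono) auto
        finally show ?thesis using t by (simp add: pos_divide_le_eq mult.commute mult.left_commute)
      qed
      ultimately show ?thesis by linarith
    qed
    then show ?thesis by blast
  qed
qed

end

theorem theorem2:
  fixes f :: "real ^ 'n \<Rightarrow> real"
    and m :: nat
    and a :: "nat \<Rightarrow> real ^ 'n"
    and b :: "nat \<Rightarrow> real"
    and xbar x0 :: "real ^ 'n"
    and \<epsilon> \<delta>0 \<beta> c R L \<gamma> \<delta> \<alpha> \<mu> Lf :: real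
    and M :: "'w measure"
    and J :: "nat \<Rightarrow> 'w \<Rightarrow> nat"
  assumes m: "m \<ge> 2"
    and f_convex: "convex_on UNIV f"
    and a_nonzero: "\<And>j. j \<in> {1..m} \<Longrightarrow> a j \<noteq> 0"
    and feasible: "halfspaces_inter m a b \<noteq> {}"
    and hoffman: "is_hoffman_constant m a \<beta>"
    and slater: "\<epsilon> > 0" "\<And>j. j \<in> {1..m} \<Longrightarrow> a j \<bullet> xbar - b j \<le> - \<epsilon>"
    and accuracy: "\<delta>0 > 0"
    and radius: "is_subgradient_radius f m a b \<beta> c \<epsilon> R"
    and L: "L = subgradient_bound f R"
    and indices: "iid_uniform_indices M m J"
  shows
    "(\<mu> > 0 \<and> strongly_convex \<mu> f \<and> Lf > 0 \<and> has_lipschitz_gradient Lf f \<and>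
      \<gamma> > 0 \<and> 0 < \<delta> \<and> \<delta> < min \<epsilon> (16 * (norm_min m a)\<^sup>2 / (\<beta>\<^sup>2 * (real m)\<^sup>2)) \<and>
      penalty_threshold m a \<beta> L \<delta> \<le> \<gamma> \<and> \<gamma> \<le> 2 * \<mu> * norm_min m a * \<delta>0 / \<delta> \<and>
      c > 2 * \<mu> * norm_min m a * \<delta>0 \<and>
      \<alpha> = 1 / (2 * (\<mu> * real m + Lf + \<gamma> * norm_max m a / (2 * \<delta>)))
      \<longrightarrow>
      (let X = halfspaces_inter m a b;
           x = (\<lambda>t \<omega>. saga_iterate (penalized_component f a b \<gamma> \<delta>) m \<alpha> x0 (\<lambda>s. J s \<omega>) t);
           xstar = arg_min_on f X;
           q = 1 - \<mu> / (2 * (\<mu> * real m + Lf + \<gamma> * norm_max m a / (2 * \<delta>)))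
       in (\<exists>C. \<forall>t. (\<integral>\<omega>. (norm (x t \<omega> - closest_point X (x t \<omega>)))\<^sup>2 \<partial>M) \<le> C * q ^ t) \<and>
          (\<exists>C. \<forall>t. (\<integral>\<omega>. (norm (x t \<omega> - xstar))\<^sup>2 \<partial>M) \<le> C * q ^ t + 2 * \<delta>0)))
     \<and>
     (bounded_level_sets f \<and> Lf > 0 \<and> has_lipschitz_gradient Lf f \<and>
      \<gamma> > 0 \<and> 0 < \<delta> \<and> \<delta> < min \<epsilon> (16 * (norm_min m a)\<^sup>2 / (\<beta>\<^sup>2 * (real m)\<^sup>2)) \<and>
      penalty_threshold m a \<beta> L \<delta> \<le> \<gamma> \<and> \<gamma> \<le> 4 * norm_min m a * \<delta>0 / \<delta> \<and>
      c > 4 * norm_min m a * \<delta>0 \<and>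
      \<alpha> = 1 / (3 * (Lf + \<gamma> * norm_max m a / (2 * \<delta>)))
      \<longrightarrow>
      (let fstar = (LEAST v. v \<in> f ` halfspaces_inter m a b);
           xav = (\<lambda>t \<omega>. saga_average (penalized_component f a b \<gamma> \<delta>) m \<alpha> x0 (\<lambda>s. J s \<omega>) t)
       in (\<exists>C. \<forall>t\<ge>1. (\<integral>\<omega>. f (xav t \<omega>) \<partial>M) - fstar \<le> C * (4 * real m / real t) + 2 * \<delta>0) \<and>
          (\<forall>\<epsilon>'>0. \<exists>T>0. \<forall>t>T. - \<gamma> * \<epsilon>' \<le> (\<integral>\<omega>. f (xav t \<omega>) \<partial>M) - fstar)))"
proof (intro conjI impI)
  have m0: "0 < m" using m by simp
  have k0: "0 < norm_min m a" by (rule norm_min_pos[OF m0 a_nonzero])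
  assume A: "\<mu> > 0 \<and> strongly_convex \<mu> f \<and> Lf > 0 \<and> has_lipschitz_gradient Lf f \<and>
      \<gamma> > 0 \<and> 0 < \<delta> \<and> \<delta> < min \<epsilon> (16 * (norm_min m a)\<^sup>2 / (\<beta>\<^sup>2 * (real m)\<^sup>2)) \<and>
      penalty_threshold m a \<beta> L \<delta> \<le> \<gamma> \<and> \<gamma> \<le> 2 * \<mu> * norm_min m a * \<delta>0 / \<delta> \<and>
      c > 2 * \<mu> * norm_min m a * \<delta>0 \<and>
      \<alpha> = 1 / (2 * (\<mu> * real m + Lf + \<gamma> * norm_max m a / (2 * \<delta>)))"
  then have acc: "\<gamma> * \<delta> \<le> 2 * \<mu> * norm_min m a * \<delta>0"
    using pos_le_divide_eq[of \<delta> \<gamma> "2 * \<mu> * norm_min m a * \<delta>0"] by blast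
  interpret penalized_problem f m a b xbar \<epsilon> \<beta> c R Lf \<gamma> \<delta>
    using A acc m0 f_convex a_nonzero hoffman slater(2) radius strongly_convex_bounded_level_sets[of \<mu> f Lf]
    unfolding L by unfold_locales auto
  have \<alpha>: "\<alpha> = 1 / (2 * (\<mu> * real m + (Lf + \<gamma> * norm_max m a / (2 * \<delta>))))"
    using A by (simp add: add.assoc)
  have q: "1 - \<mu> / (2 * (\<mu> * real m + Lf + \<gamma> * norm_max m a / (2 * \<delta>))) = 1 - \<alpha> * \<mu>"
    by (simp add: \<alpha> add.assoc)
  have f: "strongly_convex \<mu> f" "0 < \<mu>" using A by auto
  show "let X = halfspaces_inter m a b;
           x = (\<lambda>t \<omega>. saga_iterate (penalized_component f a b \<gamma> \<delta>) m \<alpha> x0 (\<lambda>s. J s \<omega>) t);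
           xstar = arg_min_on f X;
           q = 1 - \<mu> / (2 * (\<mu> * real m + Lf + \<gamma> * norm_max m a / (2 * \<delta>)))
       in (\<exists>C. \<forall>t. (\<integral>\<omega>. (norm (x t \<omega> - closest_point X (x t \<omega>)))\<^sup>2 \<partial>M) \<le> C * q ^ t) \<and>
          (\<exists>C. \<forall>t. (\<integral>\<omega>. (norm (x t \<omega> - xstar))\<^sup>2 \<partial>M) \<le> C * q ^ t + 2 * \<delta>0)"
    unfolding Let_def q
    using strongly_convex_rates[OF indices f acc \<alpha>, of x0] by blast
next
  have m0: "0 < m" using m by simp
  assume A: "bounded_level_sets f \<and> Lf > 0 \<and> has_lipschitz_gradient Lf f \<and>
      \<gamma> > 0 \<and> 0 < \<delta> \<and> \<delta> < min \<epsilon> (16 * (norm_min m a)\<^sup>2 / (\<beta>\<^sup>2 * (real m)\<^sup>2)) \<and>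
      penalty_threshold m a \<beta> L \<delta> \<le> \<gamma> \<and> \<gamma> \<le> 4 * norm_min m a * \<delta>0 / \<delta> \<and>
      c > 4 * norm_min m a * \<delta>0 \<and>
      \<alpha> = 1 / (3 * (Lf + \<gamma> * norm_max m a / (2 * \<delta>)))"
  then have acc: "\<gamma> * \<delta> \<le> 4 * norm_min m a * \<delta>0"
    using pos_le_divide_eq[of \<delta> \<gamma> "4 * norm_min m a * \<delta>0"] by blast
  interpret penalized_problem f m a b xbar \<epsilon> \<beta> c R Lf \<gamma> \<delta>
    using A acc m0 f_convex a_nonzero hoffman slater(2) radius
    unfolding L by unfold_locales auto
  have \<alpha>: "\<alpha> = 1 / (3 * (Lf + \<gamma> * norm_max m a / (2 * \<delta>)))" using A by simp
  note rates = convex_rates[OF indices acc \<alpha>, where ?x0.0 = x0]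
  show "let fstar = (LEAST v. v \<in> f ` halfspaces_inter m a b);
           xav = (\<lambda>t \<omega>. saga_average (penalized_component f a b \<gamma> \<delta>) m \<alpha> x0 (\<lambda>s. J s \<omega>) t)
       in (\<exists>C. \<forall>t\<ge>1. (\<integral>\<omega>. f (xav t \<omega>) \<partial>M) - fstar \<le> C * (4 * real m / real t) + 2 * \<delta>0) \<and>
          (\<forall>\<epsilon>'>0. \<exists>T>0. \<forall>t>T. - \<gamma> * \<epsilon>' \<le> (\<integral>\<omega>. f (xav t \<omega>) \<partial>M) - fstar)"
    unfolding Let_def
  proof (intro conjI allI impI)
    obtain C where C: "\<And>t. 1 \<le> t \<Longrightarrow> (\<integral>\<omega>. f (saga_average g m \<alpha> x0 (\<lambda>s. J s \<omega>) t) \<partial>M)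
        - (LEAST v. v \<in> f ` X) \<le> C * (4 * real m / real t) + \<delta>0"
      using rates(1) by blast
    have "(\<integral>\<omega>. f (saga_average g m \<alpha> x0 (\<lambda>s. J s \<omega>) t) \<partial>M)
        - (LEAST v. v \<in> f ` X) \<le> C * (4 * real m / real t) + 2 * \<delta>0" if "1 \<le> t" for t
      using C[OF that] accuracy by linarith
    then show "\<exists>C. \<forall>t\<ge>1. (\<integral>\<omega>. f (saga_average g m \<alpha> x0 (\<lambda>s. J s \<omega>) t) \<partial>M)
        - (LEAST v. v \<in> f ` X) \<le> C * (4 * real m / real t) + 2 * \<delta>0" by blast
  next
    fix \<epsilon>' :: real assume "0 < \<epsilon>'"
    then have "0 < \<gamma> * \<epsilon>'" using A by simp
    from rates(2)[OF this]
    show "\<exists>T>0. \<forall>t>T. - \<gamma> * \<epsilon>' \<le> (\<integral>\<omega>. f (saga_average g m \<alpha> x0 (\<lambda>s. J s \<omega>) t) \<partial>M)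
        - (LEAST v. v \<in> f ` X)" by simp
  qed
qed

end
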